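(* Let $p\ge 0$ be an integer and let $f:\mathbb{R}\to\mathbb{R}$ be smooth with $f^{(p+3)}>0$ and $f^{(p+4)}>0$ on $\mathbb{R}$. Let $\mathcal{M}_{2p+6,f}=(\mathbb{R}^{2p+6},g_{2p+6,f})$ be the pseudo-Riemannian manifold defined in the context, let $\nabla$ be its Levi-Civita connection, and let $$\alpha_{2p+6,f}:=\frac{f^{(p+3)}f^{(p+5)}}{f^{(p+4)}f^{(p+4)}},$$ regarded as a function on $\mathbb{R}^{2p+6}$ via the coordinate $y$. Then: 1. All scalar Weyl invariants of $\mathcal{M}_{2p+6,f}$ vanish. 2. If $\mathcal{M}_{2p+6,f}$ is affine $(p+3)$-curvature homogeneous, then $\alpha_{2p+6,f}$ is constant. 3. If $\phi$ is a local diffeomorphism of $\mathcal{M}_{2p+6,f}$ (a diffeomorphism from an open subset onto an open subset) such that $\phi^*\nabla=\nabla$, then $\phi^*\alpha_{2p+6,f}=\alpha_{2p+6,f}$. 4. If $\alpha_{2p+6,f}$ is non-constant, then $\mathcal{M}_{2p+6,f}$ is not locally affine homogeneous.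
   Context: Manifold. Let $(x,y,z_0,\dots,z_p,\bar x,\bar y,\bar z_0,\dots,\bar z_p)$ be coordinates on $\mathbb{R}^{2p+6}$. For smooth $f=f(y)$ put $F_{2p+6,f}(y,\vec z)=f(y)+yz_0+y^2z_1+\dots+y^{p+1}z_p$. The metric $g_{2p+6,f}$, of neutral signature $(p+3,p+3)$, is the symmetric tensor whose only non-zero components (up to symmetry) are $g(\partial_{z_i},\partial_{\bar z_j})=\delta_{ij}$, $g(\partial_x,\partial_{\bar x})=1$, $g(\partial_y,\partial_{\bar y})=1$, $g(\partial_x,\partial_x)=-2F_{2p+6,f}(y,\vec z)$. Scalar Weyl invariants: the scalar functions obtained by using the metric to contract all indices in pairs in a polynomial expression (without constant term) in the curvature tensor $R$ and its covariant derivatives $\nabla^kR$, $k\ge1$; i.e. linear combinations of complete metric contractions of tensor products of one or more of the tensors $\nabla^{k}R$, $k\ge0$ (for example the scalar curvature). Affine notions. For a torsion-free connection $\nabla$ on the tangent bundle of a manifold $M$, let $\mathcal{R}(\xi_1,\xi_2)=\nabla_{\xi_1}\nabla_{\xi_2}-\nabla_{\xi_2}\nabla_{\xi_1}-\nabla_{[\xi_1,\xi_2]}$ be the curvature operator. $(M,\nabla)$ is affine $k$-curvature homogeneous if for any $P,Q\in M$ there is a linear isomorphism $\phi:T_PM\to T_QM$ with $\phi^*\nabla^i\mathcal{R}_Q=\nabla^i\mathcal{R}_P$ for $0\le i\le k$. $(M,\nabla)$ is locally affine homogeneous if for any $P,Q\in M$ there is a diffeomorphism $\Phi$ from a neighborhood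 of $P$ to a neighborhood of $Q$ with $\Phi(P)=Q$ and $\Phi^*\nabla=\nabla$. A pseudo-Riemannian manifold is said to have these properties if its Levi-Civita connection does. *)

theory Defs
  imports "HOL-Analysis.Analysis"
begin

section \<open>Smooth maps\<close>

text \<open>Intended for open \<open>S\<close>; only the values of \<open>f\<close> on \<open>S\<close> then matter.\<close>

primrec times_differentiable_on ::
  "nat \<Rightarrow> 'a::real_normed_vector set \<Rightarrow> ('a \<Rightarrow> 'b::real_normed_vector) \<Rightarrow> bool" where
  "times_differentiable_on 0 S f \<longleftrightarrow> continuous_on S f"
| "times_differentiable_on (Suc k) S f \<longleftrightarrow>
     (\<forall>x\<in>S. f differentiable (at x)) \<and>
     (\<forall>v. times_differentiable_on k S (\<lambda>x. frechet_derivative f (at x) v))"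

definition smooth_on :: "'a::real_normed_vector set \<Rightarrow> ('a \<Rightarrow> 'b::real_normed_vector) \<Rightarrow> bool" where
  "smooth_on S f \<longleftrightarrow> (\<forall>k. times_differentiable_on k S f)"


section \<open>Connections on \<open>\<real>\<^sup>n\<close>\<close>

text \<open>
  The manifold is \<open>M = real ^ 'c\<close> and every tangent space is identified with \<open>real ^ 'c\<close> through the
  global coordinate frame. A vector field on an open set \<open>U\<close> is a total function of which only
  the values on \<open>U\<close> are meaningful.
\<close>

type_synonym 'c vfield = "real ^ 'c \<Rightarrow> real ^ 'c"

definition lie_bracket :: "'c::finite vfield \<Rightarrow> 'c vfield \<Rightarrow> 'c vfield" where
  "lie_bracket X Y = (\<lambda>q. frechet_derivative Y (at q) (X q) - frechet_derivative X (at q) (Y q))"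

text \<open>
  A connection on the tangent bundle differentiates local vector fields as well as global ones.
  The axiom \<open>local\<close> says that the result on \<open>U\<close> depends only on the values of the arguments on \<open>U\<close>.
\<close>

locale affine_connection =
  fixes nabla :: "'c::finite vfield \<Rightarrow> 'c vfield \<Rightarrow> 'c vfield"
  assumes local:
      "\<lbrakk>open U; smooth_on U X; smooth_on U Y; \<And>q. q \<in> U \<Longrightarrow> X' q = X q; \<And>q. q \<in> U \<Longrightarrow> Y' q = Y q;
        q \<in> U\<rbrakk> \<Longrightarrow> nabla X' Y' q = nabla X Y q"
    and smooth: "\<lbrakk>open U; smooth_on U X; smooth_on U Y\<rbrakk> \<Longrightarrow> smooth_on U (nabla X Y)"
    and add_left:
      "\<lbrakk>open U; smooth_on U X; smooth_on U X'; smooth_on U Y; q \<in> U\<rbrakk>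
        \<Longrightarrow> nabla (\<lambda>q. X q + X' q) Y q = nabla X Y q + nabla X' Y q"
    and scale_left:
      "\<lbrakk>open U; smooth_on U h; smooth_on U X; smooth_on U Y; q \<in> U\<rbrakk>
        \<Longrightarrow> nabla (\<lambda>q. (h q :: real) *\<^sub>R X q) Y q = h q *\<^sub>R nabla X Y q"
    and add_right:
      "\<lbrakk>open U; smooth_on U X; smooth_on U Y; smooth_on U Y'; q \<in> U\<rbrakk>
        \<Longrightarrow> nabla X (\<lambda>q. Y q + Y' q) q = nabla X Y q + nabla X Y' q"
    and leibniz:
      "\<lbrakk>open U; smooth_on U h; smooth_on U X; smooth_on U Y; q \<in> U\<rbrakk>
        \<Longrightarrow> nabla X (\<lambda>q. (h q :: real) *\<^sub>R Y q) q
           = frechet_derivative h (at q) (X q) *\<^sub>R Y q + h q *\<^sub>R nabla X Y q"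

locale torsion_free_connection = affine_connection +
  assumes torsion_free:
    "\<lbrakk>open U; smooth_on U X; smooth_on U Y; q \<in> U\<rbrakk>
      \<Longrightarrow> nabla X Y q - nabla Y X q = lie_bracket X Y q"

text \<open>A symmetric 2-tensor field is given by its matrix of components.\<close>

type_synonym 'c metric = "real ^ 'c \<Rightarrow> real ^ 'c ^ 'c"

definition metric_inner :: "'c::finite metric \<Rightarrow> real ^ 'c \<Rightarrow> real ^ 'c \<Rightarrow> real ^ 'c \<Rightarrow> real" where
  "metric_inner g q v w = v \<bullet> (g q *v w)"

locale levi_civita_connection = torsion_free_connection nabla
  for nabla :: "'c::finite vfield \<Rightarrow> 'c vfield \<Rightarrow> 'c vfield" +
  fixes g :: "'c metric"
  assumes metric_compatible:
    "\<lbrakk>open U; smooth_on U X; smooth_on U Y; smooth_on U Z; q \<in> U\<rbrakk>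
      \<Longrightarrow> frechet_derivative (\<lambda>q. metric_inner g q (Y q) (Z q)) (at q) (X q)
         = metric_inner g q (nabla X Y q) (Z q) + metric_inner g q (Y q) (nabla X Z q)"


section \<open>Curvature and its covariant derivatives\<close>

definition curvature ::
  "('c::finite vfield \<Rightarrow> 'c vfield \<Rightarrow> 'c vfield) \<Rightarrow> 'c vfield \<Rightarrow> 'c vfield \<Rightarrow> 'c vfield \<Rightarrow> 'c vfield" where
  "curvature nabla X Y Z =
     (\<lambda>q. nabla X (nabla Y Z) q - nabla Y (nabla X Z) q - nabla (lie_bracket X Y) Z q)"

text \<open>
  The list \<open>[V\<^sub>k, \<dots>, V\<^sub>1, X, Y, Z]\<close> of length \<open>k + 3\<close> is sent to the vector field
  \<open>(\<nabla>\<^sup>kR)(X, Y)Z\<close> differentiated along \<open>V\<^sub>1, \<dots>, V\<^sub>k\<close>, the head of the list being the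
  direction of the last differentiation.
\<close>

primrec nabla_curvature ::
  "('c::finite vfield \<Rightarrow> 'c vfield \<Rightarrow> 'c vfield) \<Rightarrow> nat \<Rightarrow> 'c vfield list \<Rightarrow> 'c vfield" where
  "nabla_curvature nabla 0 Xs = curvature nabla (Xs ! 0) (Xs ! 1) (Xs ! 2)"
| "nabla_curvature nabla (Suc k) Xs = (\<lambda>q.
     nabla (hd Xs) (nabla_curvature nabla k (tl Xs)) q
     - (\<Sum>j<length (tl Xs).
          nabla_curvature nabla k ((tl Xs)[j := nabla (hd Xs) (tl Xs ! j)]) q))"

text \<open>
  The value of the tensor at a point. It does not depend on how the tangent vectors are extended
  to vector fields; the constant extensions are used.
\<close>

definition nabla_curvature_at ::
  "('c::finite vfield \<Rightarrow> 'c vfield \<Rightarrow> 'c vfield) \<Rightarrow> nat \<Rightarrow> real ^ 'c \<Rightarrow> (real ^ 'c) list \<Rightarrow> real ^ 'c" where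
  "nabla_curvature_at nabla k P vs = nabla_curvature nabla k (map (\<lambda>v q. v) vs) P"


section \<open>Scalar Weyl invariants\<close>

text \<open>The component of the covariant tensor \<open>g(\<nabla>\<^sup>kR(\<dots>), \<cdot>)\<close> for a list of \<open>k + 4\<close> indices.\<close>

definition nabla_curvature_component ::
  "'c::finite metric \<Rightarrow> ('c vfield \<Rightarrow> 'c vfield \<Rightarrow> 'c vfield) \<Rightarrow> nat \<Rightarrow> 'c list \<Rightarrow> real ^ 'c \<Rightarrow> real" where
  "nabla_curvature_component g nabla k is q =
     metric_inner g q
       (nabla_curvature_at nabla k q (map (\<lambda>i. axis i 1) (take (k + 3) is)))
       (axis (is ! (k + 3)) 1)"

primrec tensor_product_component ::
  "'c::finite metric \<Rightarrow> ('c vfield \<Rightarrow> 'c vfield \<Rightarrow> 'c vfield) \<Rightarrow> nat list \<Rightarrow> 'c list \<Rightarrow> real ^ 'c \<Rightarrow> real" where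
  "tensor_product_component g nabla [] is q = 1"
| "tensor_product_component g nabla (k # ks) is q =
     nabla_curvature_component g nabla k (take (k + 4) is) q
     * tensor_product_component g nabla ks (drop (k + 4) is) q"

text \<open>
  \<open>contraction_rank ks\<close> is the number of indices of the product of the
  \<open>\<nabla>\<^sup>kR\<close>, \<open>k\<close> in \<open>ks\<close>. The permutation \<open>\<sigma>\<close> encodes the pairing: index number \<open>\<sigma> (2 j)\<close> is
  contracted with index number \<open>\<sigma> (2 j + 1)\<close>.
\<close>

definition contraction_rank :: "nat list \<Rightarrow> nat" where
  "contraction_rank ks = (\<Sum>k\<leftarrow>ks. k + 4)"

definition complete_contraction ::
  "'c::finite metric \<Rightarrow> ('c vfield \<Rightarrow> 'c vfield \<Rightarrow> 'c vfield) \<Rightarrow> nat list \<Rightarrow> (nat \<Rightarrow> nat) \<Rightarrow> real ^ 'c \<Rightarrow> real" where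
  "complete_contraction g nabla ks \<sigma> q =
     (\<Sum>is | length is = contraction_rank ks.
        (\<Prod>j<contraction_rank ks div 2.
           matrix_inv (g q) $ (is ! \<sigma> (2 * j)) $ (is ! \<sigma> (2 * j + 1)))
        * tensor_product_component g nabla ks is q)"

inductive_set scalar_weyl_invariants ::
  "'c::finite metric \<Rightarrow> ('c vfield \<Rightarrow> 'c vfield \<Rightarrow> 'c vfield) \<Rightarrow> (real ^ 'c \<Rightarrow> real) set"
  for g :: "'c metric" and nabla :: "'c vfield \<Rightarrow> 'c vfield \<Rightarrow> 'c vfield" where
  contraction:
    "\<lbrakk>ks \<noteq> []; even (contraction_rank ks); \<sigma> permutes {..<contraction_rank ks}\<rbrakk>
      \<Longrightarrow> complete_contraction g nabla ks \<sigma> \<in> scalar_weyl_invariants g nabla"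
| add:
    "\<lbrakk>I \<in> scalar_weyl_invariants g nabla; J \<in> scalar_weyl_invariants g nabla\<rbrakk>
      \<Longrightarrow> (\<lambda>q. I q + J q) \<in> scalar_weyl_invariants g nabla"
| scale:
    "I \<in> scalar_weyl_invariants g nabla \<Longrightarrow> (\<lambda>q. c * I q) \<in> scalar_weyl_invariants g nabla"


section \<open>Affine homogeneity\<close>

definition affine_curvature_homogeneous ::
  "nat \<Rightarrow> ('c::finite vfield \<Rightarrow> 'c vfield \<Rightarrow> 'c vfield) \<Rightarrow> bool" where
  "affine_curvature_homogeneous k nabla \<longleftrightarrow>
     (\<forall>P Q. \<exists>\<phi>. linear \<phi> \<and> bij \<phi> \<and>
        (\<forall>i\<le>k. \<forall>vs. length vs = i + 3 \<longrightarrow>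
           nabla_curvature_at nabla i Q (map \<phi> vs) = \<phi> (nabla_curvature_at nabla i P vs)))"

definition diffeomorphism_between ::
  "(real ^ 'c::finite) set \<Rightarrow> (real ^ 'c) set \<Rightarrow> (real ^ 'c \<Rightarrow> real ^ 'c) \<Rightarrow> bool" where
  "diffeomorphism_between U V \<phi> \<longleftrightarrow>
     open U \<and> open V \<and> bij_betw \<phi> U V \<and> smooth_on U \<phi> \<and> smooth_on V (the_inv_into U \<phi>)"

text \<open>\<open>\<psi>\<close> is the inverse of \<open>\<phi>\<close>.\<close>

definition push_forward ::
  "(real ^ 'c::finite \<Rightarrow> real ^ 'c) \<Rightarrow> (real ^ 'c \<Rightarrow> real ^ 'c) \<Rightarrow> 'c vfield \<Rightarrow> 'c vfield" where
  "push_forward \<phi> \<psi> X = (\<lambda>q. frechet_derivative \<phi> (at (\<psi> q)) (X (\<psi> q)))"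

definition pull_back_connection ::
  "(real ^ 'c::finite) set \<Rightarrow> (real ^ 'c \<Rightarrow> real ^ 'c) \<Rightarrow>
   ('c vfield \<Rightarrow> 'c vfield \<Rightarrow> 'c vfield) \<Rightarrow> 'c vfield \<Rightarrow> 'c vfield \<Rightarrow> 'c vfield" where
  "pull_back_connection U \<phi> nabla X Y =
     (let \<psi> = the_inv_into U \<phi>
      in push_forward \<psi> \<phi> (nabla (push_forward \<phi> \<psi> X) (push_forward \<phi> \<psi> Y)))"

definition preserves_connection ::
  "(real ^ 'c::finite) set \<Rightarrow> (real ^ 'c \<Rightarrow> real ^ 'c) \<Rightarrow>
   ('c vfield \<Rightarrow> 'c vfield \<Rightarrow> 'c vfield) \<Rightarrow> bool" where
  "preserves_connection U \<phi> nabla \<longleftrightarrow>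
     (\<forall>X Y. smooth_on U X \<longrightarrow> smooth_on U Y \<longrightarrow>
        (\<forall>q\<in>U. pull_back_connection U \<phi> nabla X Y q = nabla X Y q))"

definition locally_affine_homogeneous ::
  "('c::finite vfield \<Rightarrow> 'c vfield \<Rightarrow> 'c vfield) \<Rightarrow> bool" where
  "locally_affine_homogeneous nabla \<longleftrightarrow>
     (\<forall>P Q. \<exists>U V \<Phi>. P \<in> U \<and> Q \<in> V \<and> diffeomorphism_between U V \<Phi> \<and> \<Phi> P = Q \<and>
        preserves_connection U \<Phi> nabla)"


section \<open>The manifolds\<close>

text \<open>
  Names of the coordinates \<open>x, y, z\<^sub>a\<close> and their barred partners. The \<open>p + 1\<close> coordinates \<open>z\<close> are
  indexed by a type \<open>'n\<close> with \<open>p + 1\<close> elements; a bijection \<open>e\<close> from \<open>{0..p}\<close> onto \<open>'n\<close> numbers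
  them, so that \<open>z\<^sub>i\<close> is the coordinate \<open>Cz (e i)\<close>.
\<close>

datatype 'n coord = Cx | Cy | Cz 'n | Cxbar | Cybar | Czbar 'n

lemma UNIV_coord: "(UNIV :: 'n coord set) = {Cx, Cy, Cxbar, Cybar} \<union> range Cz \<union> range Czbar"
proof -
  have "c \<in> {Cx, Cy, Cxbar, Cybar} \<union> range Cz \<union> range Czbar" for c :: "'n coord"
    by (cases c) simp_all
  then show ?thesis by blast
qed

instance coord :: (finite) finite
  by standard (simp add: UNIV_coord)

lemma card_coord:
  assumes "CARD('n::finite) = p + 1"
  shows "CARD('n coord) = 2 * p + 6"
proof -
  have "card (range (Cz :: 'n \<Rightarrow> 'n coord)) = p + 1" "card (range (Czbar :: 'n \<Rightarrow> 'n coord)) = p + 1"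
    using assms by (simp_all add: card_image inj_on_def)
  moreover have "card ({Cx, Cy, Cxbar, Cybar :: 'n coord} \<union> range Cz \<union> range Czbar)
      = card {Cx, Cy, Cxbar, Cybar :: 'n coord} + card (range (Cz :: 'n \<Rightarrow> 'n coord))
        + card (range (Czbar :: 'n \<Rightarrow> 'n coord))"
    by (subst card_Un_disjoint, simp, simp, blast)+ simp
  ultimately show ?thesis
    by (simp add: UNIV_coord)
qed

definition F_fun :: "nat \<Rightarrow> (nat \<Rightarrow> 'n::finite) \<Rightarrow> (real \<Rightarrow> real) \<Rightarrow> real ^ 'n coord \<Rightarrow> real" where
  "F_fun p e f q = f (q $ Cy) + (\<Sum>i=0..p. (q $ Cy) ^ (i + 1) * q $ Cz (e i))"

definition metric_component :: "real \<Rightarrow> 'n coord \<Rightarrow> 'n coord \<Rightarrow> real" where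
  "metric_component F i j =
     (if i = Cx \<and> j = Cx then - 2 * F
      else if {i, j} = {Cx, Cxbar} \<or> {i, j} = {Cy, Cybar} \<or> (\<exists>a. {i, j} = {Cz a, Czbar a}) then 1
      else 0)"

definition g_metric :: "nat \<Rightarrow> (nat \<Rightarrow> 'n::finite) \<Rightarrow> (real \<Rightarrow> real) \<Rightarrow> 'n coord metric" where
  "g_metric p e f q = (\<chi> i j. metric_component (F_fun p e f q) i j)"

definition alpha :: "nat \<Rightarrow> (real \<Rightarrow> real) \<Rightarrow> real ^ 'n::finite coord \<Rightarrow> real" where
  "alpha p f q =
     (deriv ^^ (p + 3)) f (q $ Cy) * (deriv ^^ (p + 5)) f (q $ Cy)
     / ((deriv ^^ (p + 4)) f (q $ Cy) * (deriv ^^ (p + 4)) f (q $ Cy))"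

end

theory Submission
  imports Defs "HOL-Computational_Algebra.Polynomial"
begin

text \<open>
  The metric differs from a constant one only in \<open>g(\<partial>\<^sub>x, \<partial>\<^sub>x) = -2F\<close>, where \<open>F\<close> depends on \<open>y\<close> and the
  \<open>z\<^sub>i\<close> alone. Hence the Christoffel symbols \<open>\<Gamma>(v, w)\<close> are built from \<open>dF\<close>, take values in the span
  \<open>B\<close> of the barred coordinate fields, vanish as soon as one argument lies in \<open>B\<close>, and are constant
  along \<open>B\<close>. In particular \<open>\<Gamma>(u, \<Gamma>(v, w)) = 0\<close>, and all corrections by Christoffel symbols in
  \<open>\<nabla>\<^sup>kR\<close> drop out: at every point \<open>\<nabla>\<^sup>kR\<close> is the \<open>k\<close>-th directional derivative of
  \<open>D\<Gamma>(X)(Y, Z) - D\<Gamma>(Y)(X, Z)\<close> (\<open>nabla_curvature_eq\<close>). It again takes values in \<open>B\<close> and vanishes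
  as soon as one argument lies in \<open>B\<close>.

  Scalar Weyl invariants: as a covariant tensor \<open>\<nabla>\<^sup>kR\<close> has only components with unbarred indices,
  whereas the inverse metric has no entry with two unbarred indices. So no contraction has a non-zero
  summand (\<open>complete_contraction_eq_0\<close>).

  The function \<open>\<alpha>\<close>: the part \<open>\<Sum>\<^sub>i y\<^bsup>i+1\<^esup> z\<^sub>i\<close> of \<open>F\<close> has degree at most \<open>p + 2\<close> and disappears after \<open>p + 3\<close>
  differentiations. For \<open>k \<ge> p + 1\<close> therefore \<open>\<nabla>\<^sup>kR = f\<^bsup>(k+2)\<^esup>(y) dy\<^sup>k \<otimes> \<rho>\<close> with a constant non-zero tensor
  \<open>\<rho>\<close> (\<open>curvature_tensor_high_order\<close>). A linear isomorphism between two tangent spaces that intertwines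
  these tensors for \<open>k = p + 1, p + 2, p + 3\<close> rescales the three coefficients \<open>f\<^bsup>(p+3)\<^esup>, f\<^bsup>(p+4)\<^esup>, f\<^bsup>(p+5)\<^esup>\<close>
  by \<open>c, ct, ct\<^sup>2\<close>, and so \<open>\<alpha>\<close> takes the same value at both points (\<open>alpha_eq_of_intertwining\<close>). Affine
  curvature homogeneity provides such isomorphisms between any two points. So does the differential
  of a local diffeomorphism preserving the connection, because \<open>\<nabla>\<^sup>kR\<close> is natural
  (\<open>curvature_tensor_intertwines\<close>).

  The rest is calculus in coordinates: closure properties of smooth maps, the symmetry of second
  derivatives, the Leibniz rule for tensor fields evaluated on vector fields, and the Koszul formula.
\<close>

section \<open>Calculus of smooth maps\<close>

lemma times_differentiable_on_cong:
  assumes "open S" "\<And>x. x \<in> S \<Longrightarrow> f x = g x" "times_differentiable_on k S f"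
  shows "times_differentiable_on k S g"
  using assms
proof (induction k arbitrary: f g)
  case 0
  then show ?case by (metis continuous_on_cong times_differentiable_on.simps(1))
next
  case (Suc k)
  have diff: "f differentiable at x" if "x \<in> S" for x
    using Suc.prems that by simp
  have "g differentiable at x" if "x \<in> S" for x
    using diff[OF that] Suc.prems(1,2) that
    by (metis differentiable_def has_derivative_transform_within_open)
  moreover have "times_differentiable_on k S (\<lambda>x. frechet_derivative g (at x) v)" for v
  proof (rule Suc.IH[OF Suc.prems(1)])
    show "times_differentiable_on k S (\<lambda>x. frechet_derivative f (at x) v)"
      using Suc.prems by simp
    show "frechet_derivative f (at x) v = frechet_derivative g (at x) v" if "x \<in> S" for x
      using frechet_derivative_transform_within_open[OF diff[OF that] Suc.prems(1) that, of g]
        Suc.prems(2) by simp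
  qed
  ultimately show ?case by simp
qed

lemma times_differentiable_on_SucD:
  "times_differentiable_on (Suc k) S f \<Longrightarrow> times_differentiable_on k S f"
proof (induction k arbitrary: f)
  case 0
  then show ?case
    by (auto intro!: continuous_at_imp_continuous_on differentiable_imp_continuous_within)
next
  case (Suc k)
  have "times_differentiable_on k S (\<lambda>x. frechet_derivative f (at x) v)" for v
    using Suc.prems by (intro Suc.IH) simp
  then show ?case using Suc.prems by simp
qed

lemma times_differentiable_on_subset:
  "times_differentiable_on k S f \<Longrightarrow> T \<subseteq> S \<Longrightarrow> times_differentiable_on k T f"
  by (induction k arbitrary: f) (auto intro: continuous_on_subset)

lemma times_differentiable_on_const: "times_differentiable_on k S (\<lambda>x. c)"
  by (induction k arbitrary: c) simp_all

lemma times_differentiable_on_add: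
  assumes "open S" "times_differentiable_on k S f" "times_differentiable_on k S g"
  shows "times_differentiable_on k S (\<lambda>x. f x + g x)"
  using assms
proof (induction k arbitrary: f g)
  case 0
  then show ?case by (simp add: continuous_on_add)
next
  case (Suc k)
  have eq: "frechet_derivative (\<lambda>x. f x + g x) (at x) v
      = frechet_derivative f (at x) v + frechet_derivative g (at x) v" if "x \<in> S" for x v
    using frechet_derivative_at[OF has_derivative_add[OF
          Suc.prems(2)[simplified, THEN conjunct1, rule_format, OF that, unfolded frechet_derivative_works]
          Suc.prems(3)[simplified, THEN conjunct1, rule_format, OF that, unfolded frechet_derivative_works]]]
    by metis
  have "times_differentiable_on k S (\<lambda>x. frechet_derivative (\<lambda>x. f x + g x) (at x) v)" for v
    by (rule times_differentiable_on_cong[OF Suc.prems(1)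
          _ Suc.IH[of "\<lambda>x. frechet_derivative f (at x) v" "\<lambda>x. frechet_derivative g (at x) v"]])
      (use Suc.prems eq in auto)
  then show ?case using Suc.prems by simp
qed

lemma times_differentiable_on_scaleR:
  fixes h :: "'a::real_normed_vector \<Rightarrow> real"
  assumes "open S" "times_differentiable_on k S h" "times_differentiable_on k S f"
  shows "times_differentiable_on k S (\<lambda>x. h x *\<^sub>R f x)"
  using assms
proof (induction k arbitrary: h f)
  case 0
  then show ?case by (simp add: continuous_on_scaleR)
next
  case (Suc k)
  have diff: "h differentiable at x" "f differentiable at x" if "x \<in> S" for x
    using Suc.prems that by simp_all
  have der: "((\<lambda>x. h x *\<^sub>R f x) has_derivative
      (\<lambda>v. h x *\<^sub>R frechet_derivative f (at x) v + frechet_derivative h (at x) v *\<^sub>R f x)) (at x)"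
    if "x \<in> S" for x
    using has_derivative_scaleR diff[OF that, unfolded frechet_derivative_works] by blast
  have "times_differentiable_on k S
      (\<lambda>x. h x *\<^sub>R frechet_derivative f (at x) v + frechet_derivative h (at x) v *\<^sub>R f x)" for v
    using Suc.prems times_differentiable_on_SucD[OF Suc.prems(2)] times_differentiable_on_SucD[OF Suc.prems(3)]
    by (intro times_differentiable_on_add Suc.IH) auto
  then have "times_differentiable_on k S
      (\<lambda>x. frechet_derivative (\<lambda>x. h x *\<^sub>R f x) (at x) v)" for v
    by (rule times_differentiable_on_cong[OF Suc.prems(1), rotated])
      (simp add: frechet_derivative_at[OF der, symmetric])
  moreover have "(\<lambda>x. h x *\<^sub>R f x) differentiable at x" if "x \<in> S" for x
    using der[OF that] differentiable_def by blast
  ultimately show ?case by simp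
qed

lemma times_differentiable_on_linear:
  assumes L: "bounded_linear L" and "open S" "times_differentiable_on k S f"
  shows "times_differentiable_on k S (\<lambda>x. L (f x))"
  using assms(2,3)
proof (induction k arbitrary: f)
  case 0
  then show ?case by (simp add: bounded_linear.continuous_on[OF L])
next
  case (Suc k)
  have der: "((\<lambda>x. L (f x)) has_derivative (\<lambda>v. L (frechet_derivative f (at x) v))) (at x)"
    if "x \<in> S" for x
    using bounded_linear.has_derivative[OF L, of f "frechet_derivative f (at x)"] Suc.prems that
    by (simp add: frechet_derivative_works)
  have "times_differentiable_on k S (\<lambda>x. L (frechet_derivative f (at x) v))" for v
    using Suc.prems by (intro Suc.IH) auto
  then have "times_differentiable_on k S (\<lambda>x. frechet_derivative (\<lambda>x. L (f x)) (at x) v)" for v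
    by (rule times_differentiable_on_cong[OF Suc.prems(1), rotated])
      (simp add: frechet_derivative_at[OF der, symmetric])
  moreover have "(\<lambda>x. L (f x)) differentiable at x" if "x \<in> S" for x
    using der[OF that] differentiable_def by blast
  ultimately show ?case by simp
qed

lemma times_differentiable_on_sum:
  assumes "open S" "finite I" "\<And>i. i \<in> I \<Longrightarrow> times_differentiable_on k S (f i)"
  shows "times_differentiable_on k S (\<lambda>x. \<Sum>i\<in>I. f i x)"
  using assms(2,3)
  by (induction I rule: finite_induct)
    (auto intro: times_differentiable_on_const times_differentiable_on_add assms(1))

lemma linear_euclidean_expansion:
  fixes L :: "'a::euclidean_space \<Rightarrow> 'b::real_vector"
  assumes "linear L"
  shows "L v = (\<Sum>b\<in>Basis. (v \<bullet> b) *\<^sub>R L b)"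
  by (subst euclidean_representation[symmetric, of v])
    (simp add: linear_sum[OF assms] linear_cmul[OF assms])

text \<open>The chain rule gives the derivative of a composite in a direction \<open>v\<close> only after expanding
  \<open>D\<phi>(x) v\<close> in a basis: this turns it into a sum of products to which the induction hypothesis
  applies.\<close>

lemma times_differentiable_on_compose:
  fixes \<phi> :: "'a::real_normed_vector \<Rightarrow> 'b::euclidean_space"
  assumes "open S" "times_differentiable_on k S \<phi>" "\<phi> ` S \<subseteq> T" "times_differentiable_on k T h"
  shows "times_differentiable_on k S (\<lambda>x. h (\<phi> x))"
  using assms
proof (induction k arbitrary: h)
  case 0
  then show ?case using continuous_on_compose2 by auto
next
  case (Suc k)
  have diff: "\<phi> differentiable at x" "h differentiable at (\<phi> x)" if "x \<in> S" for x
    using Suc.prems that by auto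
  have der: "((\<lambda>x. h (\<phi> x)) has_derivative
      (\<lambda>v. frechet_derivative h (at (\<phi> x)) (frechet_derivative \<phi> (at x) v))) (at x)" if "x \<in> S" for x
    using diff_chain_at[OF diff[OF that, unfolded frechet_derivative_works]] by (simp add: o_def)
  have expand: "frechet_derivative h (at (\<phi> x)) (frechet_derivative \<phi> (at x) v)
      = (\<Sum>b\<in>Basis. (frechet_derivative \<phi> (at x) v \<bullet> b) *\<^sub>R frechet_derivative h (at (\<phi> x)) b)"
    if "x \<in> S" for x v
    using linear_euclidean_expansion[OF linear_frechet_derivative[OF diff(2)[OF that]]] .
  have "times_differentiable_on k S
      (\<lambda>x. frechet_derivative h (at (\<phi> x)) (frechet_derivative \<phi> (at x) v))" for v
  proof (rule times_differentiable_on_cong[OF Suc.prems(1) expand[symmetric]])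
    show "times_differentiable_on k S (\<lambda>x. \<Sum>b\<in>Basis.
        (frechet_derivative \<phi> (at x) v \<bullet> b) *\<^sub>R frechet_derivative h (at (\<phi> x)) b)"
      using Suc.prems times_differentiable_on_SucD[of k S \<phi>]
      by (intro times_differentiable_on_sum times_differentiable_on_scaleR Suc.IH
          times_differentiable_on_linear[where L = "\<lambda>y. y \<bullet> b" for b] bounded_linear_inner_left) auto
  qed
  then have "times_differentiable_on k S (\<lambda>x. frechet_derivative (\<lambda>x. h (\<phi> x)) (at x) v)" for v
    by (rule times_differentiable_on_cong[OF Suc.prems(1), rotated])
      (simp add: frechet_derivative_at[OF der, symmetric])
  moreover have "(\<lambda>x. h (\<phi> x)) differentiable at x" if "x \<in> S" for x
    using der[OF that] differentiable_def by blast
  ultimately show ?case by simp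
qed

lemma smooth_on_cong:
  "open S \<Longrightarrow> (\<And>x. x \<in> S \<Longrightarrow> f x = g x) \<Longrightarrow> smooth_on S f \<Longrightarrow> smooth_on S g"
  using times_differentiable_on_cong unfolding smooth_on_def by metis

lemma smooth_on_subset: "smooth_on S f \<Longrightarrow> T \<subseteq> S \<Longrightarrow> smooth_on T f"
  using times_differentiable_on_subset unfolding smooth_on_def by metis

lemma smooth_on_differentiable: "smooth_on S f \<Longrightarrow> x \<in> S \<Longrightarrow> f differentiable at x"
  unfolding smooth_on_def by (metis times_differentiable_on.simps(2))

lemma smooth_on_has_derivative:
  "smooth_on S f \<Longrightarrow> x \<in> S \<Longrightarrow> (f has_derivative frechet_derivative f (at x)) (at x)"
  using smooth_on_differentiable frechet_derivative_works by blast

lemma smooth_on_frechet_derivative: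
  "smooth_on S f \<Longrightarrow> smooth_on S (\<lambda>x. frechet_derivative f (at x) v)"
  unfolding smooth_on_def by (metis times_differentiable_on.simps(2))

lemma smooth_on_continuous: "smooth_on S f \<Longrightarrow> continuous_on S f"
  unfolding smooth_on_def by (metis times_differentiable_on.simps(1))

lemma smooth_on_const: "smooth_on S (\<lambda>x. c)"
  by (simp add: smooth_on_def times_differentiable_on_const)

lemma smooth_on_add:
  "open S \<Longrightarrow> smooth_on S f \<Longrightarrow> smooth_on S g \<Longrightarrow> smooth_on S (\<lambda>x. f x + g x)"
  by (simp add: smooth_on_def times_differentiable_on_add)

lemma smooth_on_scaleR:
  fixes h :: "'a::real_normed_vector \<Rightarrow> real"
  shows "open S \<Longrightarrow> smooth_on S h \<Longrightarrow> smooth_on S f \<Longrightarrow> smooth_on S (\<lambda>x. h x *\<^sub>R f x)"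
  by (simp add: smooth_on_def times_differentiable_on_scaleR)

lemma smooth_on_mult:
  fixes h f :: "'a::real_normed_vector \<Rightarrow> real"
  shows "open S \<Longrightarrow> smooth_on S h \<Longrightarrow> smooth_on S f \<Longrightarrow> smooth_on S (\<lambda>x. h x * f x)"
  using smooth_on_scaleR[of S h f] by simp

lemma smooth_on_power:
  fixes h :: "'a::real_normed_vector \<Rightarrow> real"
  shows "open S \<Longrightarrow> smooth_on S h \<Longrightarrow> smooth_on S (\<lambda>x. h x ^ n)"
  by (induction n) (simp_all add: smooth_on_const smooth_on_mult)

lemma smooth_on_linear:
  "bounded_linear L \<Longrightarrow> open S \<Longrightarrow> smooth_on S f \<Longrightarrow> smooth_on S (\<lambda>x. L (f x))"
  by (simp add: smooth_on_def times_differentiable_on_linear)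

lemma smooth_on_diff:
  assumes "open S" "smooth_on S f" "smooth_on S g"
  shows "smooth_on S (\<lambda>x. f x - g x)"
  using smooth_on_add[OF assms(1,2) smooth_on_linear[OF bounded_linear_minus[OF bounded_linear_ident] assms(1,3)]]
  by simp

lemma smooth_on_sum:
  "open S \<Longrightarrow> finite I \<Longrightarrow> (\<And>i. i \<in> I \<Longrightarrow> smooth_on S (f i)) \<Longrightarrow> smooth_on S (\<lambda>x. \<Sum>i\<in>I. f i x)"
  by (simp add: smooth_on_def times_differentiable_on_sum)

lemma smooth_on_compose:
  fixes \<phi> :: "'a::real_normed_vector \<Rightarrow> 'b::euclidean_space"
  shows "open S \<Longrightarrow> smooth_on S \<phi> \<Longrightarrow> \<phi> ` S \<subseteq> T \<Longrightarrow> smooth_on T h \<Longrightarrow> smooth_on S (\<lambda>x. h (\<phi> x))"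
  by (simp add: smooth_on_def times_differentiable_on_compose)

lemma smooth_on_ident: "smooth_on S (\<lambda>x. x)"
proof -
  have "times_differentiable_on k S (\<lambda>x. x)" for k
    by (cases k) (simp_all add: times_differentiable_on_const)
  then show ?thesis by (simp add: smooth_on_def)
qed

lemma smooth_on_vec_nth: "open S \<Longrightarrow> smooth_on S X \<Longrightarrow> smooth_on S (\<lambda>q. X q $ c)"
  by (rule smooth_on_linear[OF bounded_linear_vec_nth])

lemma linear_frechet_derivative_smooth_on:
  "smooth_on S f \<Longrightarrow> x \<in> S \<Longrightarrow> linear (frechet_derivative f (at x))"
  using linear_frechet_derivative smooth_on_differentiable by blast

lemma has_real_derivative_along_line:
  fixes g :: "'a::real_normed_vector \<Rightarrow> real"
  assumes g: "smooth_on S g" and x: "x + s *\<^sub>R w \<in> S"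
  shows "((\<lambda>s. g (x + s *\<^sub>R w)) has_real_derivative frechet_derivative g (at (x + s *\<^sub>R w)) w) (at s)"
proof -
  have "((\<lambda>s. x + s *\<^sub>R w) has_derivative (\<lambda>a. a *\<^sub>R w)) (at s)"
    by (auto intro!: derivative_eq_intros)
  note diff_chain_at[OF this smooth_on_has_derivative[OF g x]]
  moreover have "(*) (frechet_derivative g (at (x + s *\<^sub>R w)) w)
      = (\<lambda>a. a * frechet_derivative g (at (x + s *\<^sub>R w)) w)"
    by (intro ext) (rule mult.commute)
  ultimately show ?thesis
    using linear_cmul[OF linear_frechet_derivative_smooth_on[OF g x]]
    by (simp add: has_field_derivative_def o_def)
qed

text \<open>The Schwarz theorem, by two applications of the mean value theorem to the second difference
  \<open>h (q + ru + rv) - h (q + ru) - h (q + rv) + h q\<close>, which is symmetric in \<open>u\<close> and \<open>v\<close>.\<close>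

lemma second_difference_mean_value:
  fixes h :: "'a::real_normed_vector \<Rightarrow> real"
  assumes h: "smooth_on (ball q d) h" and r: "0 < r" and small: "r * norm u + r * norm v < d"
  obtains \<xi> \<eta> where "0 < \<xi>" "\<xi> < r" "0 < \<eta>" "\<eta> < r"
    "h (q + r *\<^sub>R u + r *\<^sub>R v) - h (q + r *\<^sub>R u) - h (q + r *\<^sub>R v) + h q
      = r * r * frechet_derivative (\<lambda>x. frechet_derivative h (at x) u) (at (q + \<xi> *\<^sub>R u + \<eta> *\<^sub>R v)) v"
proof -
  have inball: "q + s *\<^sub>R u + t *\<^sub>R v \<in> ball q d" if "0 \<le> s" "s \<le> r" "0 \<le> t" "t \<le> r" for s t
  proof -
    have "norm (s *\<^sub>R u + t *\<^sub>R v) \<le> r * norm u + r * norm v"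
      using that by (intro order_trans[OF norm_triangle_ineq] add_mono) (auto intro: mult_right_mono)
    then show ?thesis using small by (simp add: dist_norm algebra_simps norm_minus_commute)
  qed
  have d1: "((\<lambda>s. h (q + s *\<^sub>R u + t *\<^sub>R v)) has_real_derivative
      frechet_derivative h (at (q + s *\<^sub>R u + t *\<^sub>R v)) u) (at s)"
    if "0 \<le> s" "s \<le> r" "0 \<le> t" "t \<le> r" for s t
    using has_real_derivative_along_line[OF h, of "q + t *\<^sub>R v" s u] inball[OF that]
    by (simp add: add.assoc add.commute[of "t *\<^sub>R v"])
  have d2: "((\<lambda>t. frechet_derivative h (at (q + s *\<^sub>R u + t *\<^sub>R v)) u) has_real_derivative
      frechet_derivative (\<lambda>x. frechet_derivative h (at x) u) (at (q + s *\<^sub>R u + t *\<^sub>R v)) v) (at t)"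
    if "0 \<le> s" "s \<le> r" "0 \<le> t" "t \<le> r" for s t
    by (rule has_real_derivative_along_line[OF smooth_on_frechet_derivative[OF h] inball[OF that]])
  let ?\<phi> = "\<lambda>s. h (q + s *\<^sub>R u + r *\<^sub>R v) - h (q + s *\<^sub>R u + 0 *\<^sub>R v)"
  let ?Du = "\<lambda>x. frechet_derivative h (at x) u"
  have "\<exists>\<xi>>0. \<xi> < r \<and> ?\<phi> r - ?\<phi> 0
      = (r - 0) * (?Du (q + \<xi> *\<^sub>R u + r *\<^sub>R v) - ?Du (q + \<xi> *\<^sub>R u + 0 *\<^sub>R v))"
    by (rule MVT2[OF r]) (use r in \<open>intro DERIV_diff d1; simp\<close>)
  then obtain \<xi> where \<xi>: "0 < \<xi>" "\<xi> < r" "?\<phi> r - ?\<phi> 0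
      = r * (?Du (q + \<xi> *\<^sub>R u + r *\<^sub>R v) - ?Du (q + \<xi> *\<^sub>R u + 0 *\<^sub>R v))"
    by auto
  have "\<exists>\<eta>>0. \<eta> < r \<and> ?Du (q + \<xi> *\<^sub>R u + r *\<^sub>R v) - ?Du (q + \<xi> *\<^sub>R u + 0 *\<^sub>R v)
      = (r - 0) * frechet_derivative ?Du (at (q + \<xi> *\<^sub>R u + \<eta> *\<^sub>R v)) v"
    by (rule MVT2[OF r]) (use \<xi> in \<open>intro d2; simp\<close>)
  then obtain \<eta> where \<eta>: "0 < \<eta>" "\<eta> < r" "?Du (q + \<xi> *\<^sub>R u + r *\<^sub>R v) - ?Du (q + \<xi> *\<^sub>R u + 0 *\<^sub>R v)
      = r * frechet_derivative ?Du (at (q + \<xi> *\<^sub>R u + \<eta> *\<^sub>R v)) v"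
    by auto
  show ?thesis
    by (rule that[OF \<xi>(1,2) \<eta>(1,2)]) (use \<xi>(3) in \<open>simp add: \<eta>(3)[simplified]\<close>)
qed

lemma second_derivative_symmetric_real:
  fixes h :: "'a::real_normed_vector \<Rightarrow> real"
  assumes U: "open U" "q \<in> U" and h: "smooth_on U h"
  shows "frechet_derivative (\<lambda>x. frechet_derivative h (at x) u) (at q) v
       = frechet_derivative (\<lambda>x. frechet_derivative h (at x) v) (at q) u"
proof -
  let ?H = "\<lambda>u v x. frechet_derivative (\<lambda>x. frechet_derivative h (at x) u) (at x) v"
  have cont: "isCont (?H u v) q" for u v
    using smooth_on_continuous[OF smooth_on_frechet_derivative[OF smooth_on_frechet_derivative[OF h]]] U
    by (simp add: continuous_on_eq_continuous_at)
  have "\<bar>?H u v q - ?H v u q\<bar> \<le> e" if e: "e > 0" for e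
  proof -
    obtain d0 where d0: "d0 > 0" "ball q d0 \<subseteq> U"
      using U open_contains_ball by blast
    obtain d1 where d1: "d1 > 0" "\<And>x. dist x q < d1 \<Longrightarrow> dist (?H u v x) (?H u v q) < e / 2"
      using cont[of u v] e unfolding continuous_at_eps_delta by (metis half_gt_zero)
    obtain d2 where d2: "d2 > 0" "\<And>x. dist x q < d2 \<Longrightarrow> dist (?H v u x) (?H v u q) < e / 2"
      using cont[of v u] e unfolding continuous_at_eps_delta by (metis half_gt_zero)
    define d where "d = min d0 (min d1 d2)"
    have d: "d > 0" "d \<le> d0" "d \<le> d1" "d \<le> d2" using d0 d1 d2 by (auto simp: d_def)
    define r where "r = d / (2 * (norm u + norm v + 1))"
    \<comment> \<open>the \<open>+ 1\<close> keeps the denominator positive when \<open>u = v = 0\<close>\<close>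
    have pos: "norm u + norm v + 1 > 0" by (smt (verit) norm_ge_zero)
    have r: "r > 0" using d pos by (simp add: r_def)
    have "r * norm u + r * norm v \<le> r * (norm u + norm v + 1)"
      using r by (simp add: algebra_simps)
    also have "\<dots> = d / 2" using pos unfolding r_def by (metis less_irrefl nonzero_eq_divide_eq times_divide_eq_left mult.commute divide_divide_eq_left)
    finally have small: "r * norm u + r * norm v < d" using d by simp
    have near: "dist (q + s *\<^sub>R u + t *\<^sub>R v) q < d" if "0 < s" "s < r" "0 < t" "t < r" for s t
    proof -
      have "norm (s *\<^sub>R u + t *\<^sub>R v) \<le> r * norm u + r * norm v"
        using that by (intro order_trans[OF norm_triangle_ineq] add_mono) (auto intro: mult_right_mono)
      then show ?thesis using small by (simp add: dist_norm algebra_simps)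
    qed
    have hb: "smooth_on (ball q d) h"
      using smooth_on_subset[OF h] d0 d by (meson order_trans subset_ball)
    obtain s t where st: "0 < s" "s < r" "0 < t" "t < r"
      "h (q + r *\<^sub>R u + r *\<^sub>R v) - h (q + r *\<^sub>R u) - h (q + r *\<^sub>R v) + h q
        = r * r * ?H u v (q + s *\<^sub>R u + t *\<^sub>R v)"
      using second_difference_mean_value[OF hb r small] by blast
    obtain s' t' where st': "0 < s'" "s' < r" "0 < t'" "t' < r"
      "h (q + r *\<^sub>R v + r *\<^sub>R u) - h (q + r *\<^sub>R v) - h (q + r *\<^sub>R u) + h q
        = r * r * ?H v u (q + s' *\<^sub>R v + t' *\<^sub>R u)"
      using second_difference_mean_value[OF hb r, of v u] small by (metis add.commute)
    have "r * r * ?H u v (q + s *\<^sub>R u + t *\<^sub>R v) = r * r * ?H v u (q + t' *\<^sub>R u + s' *\<^sub>R v)"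
      using st(5) st'(5) by (simp add: algebra_simps)
    then have eq: "?H u v (q + s *\<^sub>R u + t *\<^sub>R v) = ?H v u (q + t' *\<^sub>R u + s' *\<^sub>R v)"
      using r by simp
    have "dist (?H u v (q + s *\<^sub>R u + t *\<^sub>R v)) (?H u v q) < e / 2"
      using d1(2) near[OF st(1-4)] d by (meson order_less_le_trans)
    moreover have "dist (?H v u (q + t' *\<^sub>R u + s' *\<^sub>R v)) (?H v u q) < e / 2"
      using d2(2) near[OF st'(3,4,1,2)] d by (meson order_less_le_trans)
    ultimately show ?thesis using eq unfolding dist_real_def by linarith
  qed
  then show ?thesis
    by (metis abs_le_zero_iff eq_iff_diff_eq_0 field_le_epsilon add.left_neutral)
qed

lemma frechet_derivative_vec_nth:
  "f differentiable at q \<Longrightarrow> frechet_derivative (\<lambda>x. f x $ c) (at q) v = frechet_derivative f (at q) v $ c"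
  using frechet_derivative_at[OF bounded_linear.has_derivative[OF bounded_linear_vec_nth]]
  by (metis frechet_derivative_works)

lemma second_derivative_symmetric:
  fixes Z :: "'a::real_normed_vector \<Rightarrow> real ^ 'c::finite"
  assumes U: "open U" "q \<in> U" and Z: "smooth_on U Z"
  shows "frechet_derivative (\<lambda>x. frechet_derivative Z (at x) u) (at q) v
       = frechet_derivative (\<lambda>x. frechet_derivative Z (at x) v) (at q) u"
proof (subst vec_eq_iff, rule allI)
  fix c
  have Zd: "(\<lambda>x. frechet_derivative Z (at x) u) differentiable at q" for u
    using smooth_on_differentiable[OF smooth_on_frechet_derivative[OF Z] U(2)] .
  have comp: "frechet_derivative (\<lambda>x. frechet_derivative Z (at x) u) (at q) v $ c
      = frechet_derivative (\<lambda>x. frechet_derivative (\<lambda>x. Z x $ c) (at x) u) (at q) v" for u v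
    unfolding frechet_derivative_vec_nth[OF Zd, symmetric]
    by (rule fun_cong[OF frechet_derivative_transform_within_open[OF
            smooth_on_differentiable[OF smooth_on_vec_nth[OF U(1) smooth_on_frechet_derivative[OF Z]] U(2)] U]])
      (simp add: frechet_derivative_vec_nth smooth_on_differentiable[OF Z])
  show "frechet_derivative (\<lambda>x. frechet_derivative Z (at x) u) (at q) v $ c
      = frechet_derivative (\<lambda>x. frechet_derivative Z (at x) v) (at q) u $ c"
    unfolding comp by (rule second_derivative_symmetric_real[OF U smooth_on_vec_nth[OF U(1) Z]])
qed

section \<open>Tensor fields evaluated on vector fields\<close>

lemma frechet_derivative_cong_on:
  "open U \<Longrightarrow> q \<in> U \<Longrightarrow> smooth_on U f \<Longrightarrow> (\<And>x. x \<in> U \<Longrightarrow> f x = g x) \<Longrightarrow>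
    frechet_derivative f (at q) = frechet_derivative g (at q)"
  using frechet_derivative_transform_within_open smooth_on_differentiable by metis

text \<open>A covariant tensor field of rank \<open>n\<close> takes lists of \<open>n\<close> vectors. Linearity is required in the
  head of the list and, recursively, of the field obtained by inserting a fixed vector there; this
  makes induction on the rank possible.\<close>

primrec smooth_tensor ::
  "'a::euclidean_space set \<Rightarrow> nat \<Rightarrow> ('a \<Rightarrow> 'a list \<Rightarrow> 'b::real_normed_vector) \<Rightarrow> bool" where
  "smooth_tensor U 0 T \<longleftrightarrow> smooth_on U (\<lambda>q. T q [])"
| "smooth_tensor U (Suc n) T \<longleftrightarrow>
     (\<forall>q\<in>U. \<forall>vs. length vs = n \<longrightarrow> linear (\<lambda>v. T q (v # vs))) \<and>
     (\<forall>v. smooth_tensor U n (\<lambda>q vs. T q (v # vs)))"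

lemma smooth_tensor_smooth_on:
  "smooth_tensor U n T \<Longrightarrow> length vs = n \<Longrightarrow> smooth_on U (\<lambda>q. T q vs)"
proof (induction n arbitrary: T vs)
  case (Suc n)
  then obtain v ws where "vs = v # ws" "length ws = n" by (metis length_Suc_conv)
  then show ?case using Suc.IH[of "\<lambda>q vs. T q (v # vs)" ws] Suc.prems by simp
qed simp

lemma smooth_tensor_mono: "smooth_tensor U n T \<Longrightarrow> V \<subseteq> U \<Longrightarrow> smooth_tensor V n T"
  by (induction n arbitrary: T) (auto intro: smooth_on_subset)

lemma smooth_tensor_update_add:
  "smooth_tensor U n T \<Longrightarrow> length vs = n \<Longrightarrow> j < n \<Longrightarrow> q \<in> U \<Longrightarrow>
    T q (vs[j := a + b]) = T q (vs[j := a]) + T q (vs[j := b])"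
proof (induction n arbitrary: T vs j)
  case (Suc n)
  then obtain v ws where vs: "vs = v # ws" "length ws = n" by (metis length_Suc_conv)
  show ?case
  proof (cases j)
    case 0
    have "linear (\<lambda>v. T q (v # ws))" using Suc.prems vs by simp
    then show ?thesis using linear_add[of "\<lambda>v. T q (v # ws)" a b] by (simp add: vs 0)
  next
    case (Suc i)
    then show ?thesis using Suc.IH[of "\<lambda>q vs. T q (v # vs)" ws i] Suc.prems vs by simp
  qed
qed simp

lemma has_derivative_frame_expansion:
  fixes X :: "'a::euclidean_space \<Rightarrow> 'a" and E :: "'a \<Rightarrow> 'a \<Rightarrow> 'b::real_normed_vector"
  assumes "smooth_on U X" "\<And>b. smooth_on U (E b)" "q \<in> U"
  shows "((\<lambda>q. \<Sum>b\<in>Basis. (X q \<bullet> b) *\<^sub>R E b q) has_derivative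
    (\<lambda>v. \<Sum>b\<in>Basis. (X q \<bullet> b) *\<^sub>R frechet_derivative (E b) (at q) v
        + (frechet_derivative X (at q) v \<bullet> b) *\<^sub>R E b q)) (at q)"
  by (intro has_derivative_sum has_derivative_scaleR
      bounded_linear.has_derivative[OF bounded_linear_inner_left]
      smooth_on_has_derivative[OF _ assms(3)] assms)

lemma smooth_on_frame_expansion:
  fixes X :: "'a::euclidean_space \<Rightarrow> 'a" and E :: "'a \<Rightarrow> 'a \<Rightarrow> 'b::real_normed_vector"
  assumes "open U" "smooth_on U X" "\<And>b. smooth_on U (E b)"
  shows "smooth_on U (\<lambda>q. \<Sum>b\<in>Basis. (X q \<bullet> b) *\<^sub>R E b q)"
  using assms by (intro smooth_on_sum smooth_on_scaleR
      smooth_on_linear[where L = "\<lambda>y. y \<bullet> b" for b] bounded_linear_inner_left) auto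

lemma frechet_derivative_smooth_tensor_head:
  assumes U: "open U" "q \<in> U" and T: "smooth_tensor U (Suc n) T" and ws: "length ws = n"
  shows "linear (\<lambda>v. frechet_derivative (\<lambda>q. T q (v # ws)) (at q) w)"
proof -
  have lin: "linear (\<lambda>v. T x (v # ws))" if "x \<in> U" for x using T ws that by simp
  have sm: "smooth_on U (\<lambda>q. T q (v # ws))" for v
    using smooth_tensor_smooth_on[OF T, of "v # ws"] ws by simp
  note der = smooth_on_has_derivative[OF sm U(2)]
  show ?thesis
  proof (rule linearI)
    fix a b
    have "frechet_derivative (\<lambda>q. T q ((a + b) # ws)) (at q)
        = frechet_derivative (\<lambda>q. T q (a # ws) + T q (b # ws)) (at q)"
      by (rule frechet_derivative_cong_on[OF U sm]) (simp add: linear_add[OF lin])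
    then show "frechet_derivative (\<lambda>q. T q ((a + b) # ws)) (at q) w
        = frechet_derivative (\<lambda>q. T q (a # ws)) (at q) w + frechet_derivative (\<lambda>q. T q (b # ws)) (at q) w"
      by (simp add: frechet_derivative_at[OF has_derivative_add[OF der[of a] der[of b]], symmetric])
  next
    fix c a
    have "frechet_derivative (\<lambda>q. T q ((c *\<^sub>R a) # ws)) (at q)
        = frechet_derivative (\<lambda>q. c *\<^sub>R T q (a # ws)) (at q)"
      by (rule frechet_derivative_cong_on[OF U sm]) (simp add: linear_cmul[OF lin])
    then show "frechet_derivative (\<lambda>q. T q ((c *\<^sub>R a) # ws)) (at q) w
        = c *\<^sub>R frechet_derivative (\<lambda>q. T q (a # ws)) (at q) w"
      by (simp add: frechet_derivative_at[OF has_derivative_scaleR_right[OF der[of a]], symmetric])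
  qed
qed

lemma smooth_tensor_frechet_derivative:
  assumes U: "open U" and "smooth_tensor U n T"
  shows "smooth_tensor U n (\<lambda>q vs. frechet_derivative (\<lambda>q. T q vs) (at q) w)"
  using assms(2)
proof (induction n arbitrary: T)
  case 0
  then show ?case by (simp add: smooth_on_frechet_derivative)
next
  case (Suc n)
  have "smooth_tensor U n (\<lambda>q vs. frechet_derivative (\<lambda>q. T q (v # vs)) (at q) w)" for v
    by (rule Suc.IH[of "\<lambda>q vs. T q (v # vs)"]) (use Suc.prems in simp)
  then show ?case
    using frechet_derivative_smooth_tensor_head[OF U _ Suc.prems] by simp
qed

lemma smooth_tensor_Suc_frechet_derivative:
  assumes U: "open U" and T: "smooth_tensor U n T"
  shows "smooth_tensor U (Suc n) (\<lambda>q vs. frechet_derivative (\<lambda>q. T q (tl vs)) (at q) (hd vs))"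
  using smooth_tensor_frechet_derivative[OF U T]
    linear_frechet_derivative_smooth_on[OF smooth_tensor_smooth_on[OF T]]
  by simp

text \<open>The Leibniz rule. Expanding the head field in the standard basis reduces the rank by one.\<close>

lemma smooth_tensor_leibniz:
  assumes U: "open U"
    and "smooth_tensor U n T" "length Xs = n" "\<And>X. X \<in> set Xs \<Longrightarrow> smooth_on U X"
  shows "smooth_on U (\<lambda>q. T q (map (\<lambda>X. X q) Xs)) \<and>
    (\<forall>q\<in>U. \<forall>v. frechet_derivative (\<lambda>q. T q (map (\<lambda>X. X q) Xs)) (at q) v =
      frechet_derivative (\<lambda>x. T x (map (\<lambda>X. X q) Xs)) (at q) v
      + (\<Sum>j<n. T q ((map (\<lambda>X. X q) Xs)[j := frechet_derivative (Xs ! j) (at q) v])))"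
  using assms(2-)
proof (induction n arbitrary: T Xs)
  case 0
  then show ?case by simp
next
  case (Suc n)
  obtain X Ys where Xs: "Xs = X # Ys" "length Ys = n"
    using Suc.prems(2) by (metis length_Suc_conv)
  have X: "smooth_on U X" and Ys: "\<And>Y. Y \<in> set Ys \<Longrightarrow> smooth_on U Y"
    using Suc.prems(3) Xs by auto
  define E where "E b q = T q (b # map (\<lambda>Y. Y q) Ys)" for b q
  have IH: "smooth_on U (E b)"
    "\<And>q v. q \<in> U \<Longrightarrow> frechet_derivative (E b) (at q) v =
      frechet_derivative (\<lambda>x. T x (b # map (\<lambda>X. X q) Ys)) (at q) v
      + (\<Sum>j<n. T q (b # (map (\<lambda>X. X q) Ys)[j := frechet_derivative (Ys ! j) (at q) v]))" for b
    using Suc.IH[of "\<lambda>q vs. T q (b # vs)" Ys] Suc.prems Xs Ys unfolding E_def by auto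
  have lin: "linear (\<lambda>v. T q (v # vs))" if "q \<in> U" "length vs = n" for q vs
    using Suc.prems that by simp
  have eq: "(\<Sum>b\<in>Basis. (X q \<bullet> b) *\<^sub>R E b q) = T q (map (\<lambda>X. X q) Xs)" if "q \<in> U" for q
    using linear_euclidean_expansion[OF lin[OF that, of "map (\<lambda>Y. Y q) Ys"], of "X q"] Xs
    by (simp add: E_def)
  have smooth: "smooth_on U (\<lambda>q. T q (map (\<lambda>X. X q) Xs))"
    by (rule smooth_on_cong[OF U eq smooth_on_frame_expansion[OF U X IH(1)]])
  have "frechet_derivative (\<lambda>q. T q (map (\<lambda>X. X q) Xs)) (at q) v =
      frechet_derivative (\<lambda>x. T x (map (\<lambda>X. X q) Xs)) (at q) v
      + (\<Sum>j<Suc n. T q ((map (\<lambda>X. X q) Xs)[j := frechet_derivative (Xs ! j) (at q) v]))"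
    if q: "q \<in> U" for q v
  proof -
    let ?ys = "map (\<lambda>X. X q) Ys"
    let ?DX = "frechet_derivative X (at q) v"
    have "frechet_derivative (\<lambda>q. T q (map (\<lambda>X. X q) Xs)) (at q) v
        = frechet_derivative (\<lambda>q. \<Sum>b\<in>Basis. (X q \<bullet> b) *\<^sub>R E b q) (at q) v"
      by (rule fun_cong[OF frechet_derivative_cong_on[OF U q smooth]]) (simp add: eq)
    also have "\<dots> = (\<Sum>b\<in>Basis. (X q \<bullet> b) *\<^sub>R frechet_derivative (E b) (at q) v + (?DX \<bullet> b) *\<^sub>R E b q)"
      by (simp add: frechet_derivative_at[OF has_derivative_frame_expansion[OF X IH(1) q], symmetric])
    also have "\<dots> = (\<Sum>b\<in>Basis. (X q \<bullet> b) *\<^sub>R frechet_derivative (\<lambda>x. T x (b # ?ys)) (at q) v)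
        + (\<Sum>b\<in>Basis. \<Sum>j<n. (X q \<bullet> b) *\<^sub>R T q (b # ?ys[j := frechet_derivative (Ys ! j) (at q) v]))
        + (\<Sum>b\<in>Basis. (?DX \<bullet> b) *\<^sub>R T q (b # ?ys))"
      by (simp add: IH(2)[OF q] E_def sum.distrib scaleR_add_right scaleR_sum_right)
    also have "(\<Sum>b\<in>Basis. (X q \<bullet> b) *\<^sub>R frechet_derivative (\<lambda>x. T x (b # ?ys)) (at q) v)
        = frechet_derivative (\<lambda>x. T x (X q # ?ys)) (at q) v"
      by (rule linear_euclidean_expansion[symmetric, OF
            frechet_derivative_smooth_tensor_head[OF U q Suc.prems(1)]]) (simp add: Xs)
    also have "(\<Sum>b\<in>Basis. (?DX \<bullet> b) *\<^sub>R T q (b # ?ys)) = T q (?DX # ?ys)"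
      by (rule linear_euclidean_expansion[symmetric, OF lin[OF q]]) (simp add: Xs)
    also have "(\<Sum>b\<in>Basis. \<Sum>j<n. (X q \<bullet> b) *\<^sub>R T q (b # ?ys[j := frechet_derivative (Ys ! j) (at q) v]))
        = (\<Sum>j<n. T q (X q # ?ys[j := frechet_derivative (Ys ! j) (at q) v]))"
      by (subst sum.swap, rule sum.cong[OF refl],
          rule linear_euclidean_expansion[symmetric, OF lin[OF q]]) (simp add: Xs)
    finally show ?thesis
      by (simp add: Xs(1) sum.lessThan_Suc_shift del: sum.lessThan_Suc)
  qed
  with smooth show ?case by blast
qed

lemma smooth_on_frechet_derivative_along:
  fixes Z :: "'a::euclidean_space \<Rightarrow> 'b::real_normed_vector"
  assumes U: "open U" and Z: "smooth_on U Z" and Y: "smooth_on U Y"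
  shows "smooth_on U (\<lambda>q. frechet_derivative Z (at q) (Y q))"
    and "q \<in> U \<Longrightarrow> frechet_derivative (\<lambda>q. frechet_derivative Z (at q) (Y q)) (at q) v
      = frechet_derivative (\<lambda>x. frechet_derivative Z (at x) (Y q)) (at q) v
        + frechet_derivative Z (at q) (frechet_derivative Y (at q) v)"
  using smooth_tensor_leibniz[OF U, of 1 "\<lambda>q vs. frechet_derivative Z (at q) (hd vs)" "[Y]"] Y
    linear_frechet_derivative_smooth_on[OF Z] smooth_on_frechet_derivative[OF Z]
  by simp_all

section \<open>Connections in the coordinate frame\<close>

context affine_connection
begin

definition christoffel :: "real ^ 'c \<Rightarrow> real ^ 'c \<Rightarrow> real ^ 'c \<Rightarrow> real ^ 'c" where
  "christoffel q v w = nabla (\<lambda>_. v) (\<lambda>_. w) q"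

lemma nabla_zero_left: "open U \<Longrightarrow> smooth_on U Y \<Longrightarrow> q \<in> U \<Longrightarrow> nabla (\<lambda>_. 0) Y q = 0"
  using scale_left[of U "\<lambda>_. 0" "\<lambda>_. 0" Y q] by (simp add: smooth_on_const)

lemma nabla_zero_right: "open U \<Longrightarrow> smooth_on U X \<Longrightarrow> q \<in> U \<Longrightarrow> nabla X (\<lambda>_. 0) q = 0"
  using leibniz[of U "\<lambda>_. 0" X "\<lambda>_. 0" q] by (simp add: smooth_on_const)

lemma nabla_sum_left:
  assumes U: "open U" and Y: "smooth_on U Y" and q: "q \<in> U" and "finite I"
    and "\<And>i. i \<in> I \<Longrightarrow> smooth_on U (h i)"
  shows "nabla (\<lambda>q. \<Sum>i\<in>I. h i q *\<^sub>R b i) Y q = (\<Sum>i\<in>I. h i q *\<^sub>R nabla (\<lambda>_. b i) Y q)"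
  using assms(4,5)
proof (induction I rule: finite_induct)
  case empty
  then show ?case by (simp add: nabla_zero_left[OF U Y q])
next
  case (insert i I)
  have "smooth_on U (\<lambda>q. h i q *\<^sub>R b i)" "smooth_on U (\<lambda>q. \<Sum>i\<in>I. h i q *\<^sub>R b i)"
    using insert by (intro smooth_on_scaleR smooth_on_sum smooth_on_const U; simp)+
  then show ?case
    using insert add_left[OF U _ _ Y q] scale_left[OF U _ smooth_on_const Y q, of "h i" "b i"] by simp
qed

lemma nabla_sum_right:
  assumes U: "open U" and X: "smooth_on U X" and q: "q \<in> U" and "finite I"
    and "\<And>i. i \<in> I \<Longrightarrow> smooth_on U (h i)"
  shows "nabla X (\<lambda>q. \<Sum>i\<in>I. h i q *\<^sub>R b i) q
    = (\<Sum>i\<in>I. frechet_derivative (h i) (at q) (X q) *\<^sub>R b i + h i q *\<^sub>R nabla X (\<lambda>_. b i) q)"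
  using assms(4,5)
proof (induction I rule: finite_induct)
  case empty
  then show ?case by (simp add: nabla_zero_right[OF U X q])
next
  case (insert i I)
  have "smooth_on U (\<lambda>q. h i q *\<^sub>R b i)" "smooth_on U (\<lambda>q. \<Sum>i\<in>I. h i q *\<^sub>R b i)"
    using insert by (intro smooth_on_scaleR smooth_on_sum smooth_on_const U; simp)+
  then show ?case
    using insert add_right[OF U X _ _ q] leibniz[OF U _ X smooth_on_const q, of "h i" "b i"] by simp
qed

lemma nabla_frame_expansion:
  assumes U: "open U" and X: "smooth_on U X" and Y: "smooth_on U Y" and q: "q \<in> U"
  shows "nabla X Y q = frechet_derivative Y (at q) (X q)
    + (\<Sum>b\<in>Basis. (Y q \<bullet> b) *\<^sub>R (\<Sum>c\<in>Basis. (X q \<bullet> c) *\<^sub>R christoffel q c b))"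
proof -
  have smooth_comp: "smooth_on U (\<lambda>q. W q \<bullet> b)" if "smooth_on U W" for W :: "'c vfield" and b
    by (rule smooth_on_linear[OF bounded_linear_inner_left U that])
  have left: "nabla X (\<lambda>_. b) q = (\<Sum>c\<in>Basis. (X q \<bullet> c) *\<^sub>R christoffel q c b)" for b
  proof -
    have "nabla X (\<lambda>_. b) q = nabla (\<lambda>q. \<Sum>c\<in>Basis. (X q \<bullet> c) *\<^sub>R c) (\<lambda>_. b) q"
      by (simp add: euclidean_representation)
    also have "\<dots> = (\<Sum>c\<in>Basis. (X q \<bullet> c) *\<^sub>R christoffel q c b)"
      unfolding christoffel_def
      using X by (intro nabla_sum_left[OF U smooth_on_const q] smooth_comp) auto
    finally show ?thesis .
  qed
  have "nabla X Y q = nabla X (\<lambda>q. \<Sum>b\<in>Basis. (Y q \<bullet> b) *\<^sub>R b) q"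
    by (simp add: euclidean_representation)
  also have "\<dots> = (\<Sum>b\<in>Basis. frechet_derivative (\<lambda>q. Y q \<bullet> b) (at q) (X q) *\<^sub>R b
      + (Y q \<bullet> b) *\<^sub>R nabla X (\<lambda>_. b) q)"
    using Y by (intro nabla_sum_right[OF U X q] smooth_comp) auto
  also have "\<dots> = (\<Sum>b\<in>Basis. (frechet_derivative Y (at q) (X q) \<bullet> b) *\<^sub>R b)
      + (\<Sum>b\<in>Basis. (Y q \<bullet> b) *\<^sub>R nabla X (\<lambda>_. b) q)"
    by (simp add: sum.distrib frechet_derivative_at[OF
          bounded_linear.has_derivative[OF bounded_linear_inner_left smooth_on_has_derivative[OF Y q]], symmetric])
  also have "(\<Sum>b\<in>Basis. (Y q \<bullet> b) *\<^sub>R nabla X (\<lambda>_. b) q)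
      = (\<Sum>b\<in>Basis. (Y q \<bullet> b) *\<^sub>R (\<Sum>c\<in>Basis. (X q \<bullet> c) *\<^sub>R christoffel q c b))"
    by (simp add: left)
  finally show ?thesis by (simp add: euclidean_representation)
qed

lemma christoffel_frame_expansion:
  "christoffel q v w = (\<Sum>b\<in>Basis. (w \<bullet> b) *\<^sub>R (\<Sum>c\<in>Basis. (v \<bullet> c) *\<^sub>R christoffel q c b))"
  using nabla_frame_expansion[of UNIV "\<lambda>_. v" "\<lambda>_. w" q]
  by (simp add: smooth_on_const christoffel_def)

text \<open>The Leibniz rule and the linearity over functions determine a connection by its values on a frame.\<close>

theorem nabla_eq:
  assumes "open U" "smooth_on U X" "smooth_on U Y" "q \<in> U"
  shows "nabla X Y q = frechet_derivative Y (at q) (X q) + christoffel q (X q) (Y q)"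
  using nabla_frame_expansion[OF assms] christoffel_frame_expansion by metis

lemma linear_christoffel_left: "linear (\<lambda>v. christoffel q v w)"
  by (subst christoffel_frame_expansion, rule linearI)
    (simp_all add: inner_left_distrib scaleR_add_left sum.distrib scaleR_add_right scaleR_sum_right mult_ac)

lemma linear_christoffel_right: "linear (christoffel q v)"
proof -
  have "linear (\<lambda>w. \<Sum>b\<in>Basis. (w \<bullet> b) *\<^sub>R (\<Sum>c\<in>Basis. (v \<bullet> c) *\<^sub>R christoffel q c b))"
    by (rule linearI)
      (simp_all add: inner_left_distrib scaleR_add_left sum.distrib scaleR_sum_right[symmetric] scaleR_scaleR[symmetric] del: scaleR_scaleR)
  then show ?thesis by (simp add: christoffel_frame_expansion[symmetric])
qed

lemma smooth_on_christoffel: "smooth_on UNIV (\<lambda>q. christoffel q v w)"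
  unfolding christoffel_def using smooth[of UNIV "\<lambda>_. v" "\<lambda>_. w"] by (simp add: smooth_on_const)

lemma smooth_tensor_christoffel:
  "smooth_tensor UNIV 2 (\<lambda>q vs. christoffel q (vs ! 0) (vs ! 1))"
  by (simp add: numeral_2_eq_2 linear_christoffel_left linear_christoffel_right smooth_on_christoffel length_Suc_conv)

lemma christoffel_leibniz:
  assumes U: "open U" and X: "smooth_on U X" and Y: "smooth_on U Y"
  shows "smooth_on U (\<lambda>q. christoffel q (X q) (Y q))"
    and "q \<in> U \<Longrightarrow> frechet_derivative (\<lambda>q. christoffel q (X q) (Y q)) (at q) v
      = frechet_derivative (\<lambda>x. christoffel x (X q) (Y q)) (at q) v
        + christoffel q (frechet_derivative X (at q) v) (Y q)
        + christoffel q (X q) (frechet_derivative Y (at q) v)"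
  using smooth_tensor_leibniz[OF U smooth_tensor_mono[OF smooth_tensor_christoffel subset_UNIV], of "[X, Y]"] X Y
  by (auto simp: numeral_2_eq_2 add.assoc)

lemma smooth_on_lie_bracket:
  assumes "open U" "smooth_on U X" "smooth_on U Y"
  shows "smooth_on U (lie_bracket X Y)"
  unfolding lie_bracket_def
  using assms by (intro smooth_on_diff smooth_on_frechet_derivative_along)

text \<open>In \<open>\<nabla>\<^sub>X\<nabla>\<^sub>Y Z - \<nabla>\<^sub>Y\<nabla>\<^sub>X Z\<close> the second derivatives of \<open>Z\<close> cancel by the Schwarz theorem, and the terms
  with first derivatives of \<open>X\<close> and \<open>Y\<close> are cancelled by \<open>\<nabla>\<^bsub>[X, Y]\<^esub> Z\<close>.\<close>

theorem curvature_eq: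
  assumes U: "open U" and X: "smooth_on U X" and Y: "smooth_on U Y" and Z: "smooth_on U Z"
    and q: "q \<in> U"
  shows "curvature nabla X Y Z q =
      frechet_derivative (\<lambda>x. christoffel x (Y q) (Z q)) (at q) (X q)
    - frechet_derivative (\<lambda>x. christoffel x (X q) (Z q)) (at q) (Y q)
    + christoffel q (X q) (christoffel q (Y q) (Z q))
    - christoffel q (Y q) (christoffel q (X q) (Z q))"
proof -
  have second: "nabla V (nabla W Z) q =
      frechet_derivative (\<lambda>x. frechet_derivative Z (at x) (W q)) (at q) (V q)
    + frechet_derivative Z (at q) (frechet_derivative W (at q) (V q))
    + frechet_derivative (\<lambda>x. christoffel x (W q) (Z q)) (at q) (V q)
    + christoffel q (frechet_derivative W (at q) (V q)) (Z q)
    + christoffel q (W q) (frechet_derivative Z (at q) (V q))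
    + christoffel q (V q) (frechet_derivative Z (at q) (W q))
    + christoffel q (V q) (christoffel q (W q) (Z q))"
    if V: "smooth_on U V" and W: "smooth_on U W" for V W
  proof -
    note along = smooth_on_frechet_derivative_along[OF U Z W]
    note chr = christoffel_leibniz[OF U W Z]
    have "nabla V (nabla W Z) q = frechet_derivative (nabla W Z) (at q) (V q)
        + christoffel q (V q) (nabla W Z q)"
      by (rule nabla_eq[OF U V smooth[OF U W Z] q])
    also have "frechet_derivative (nabla W Z) (at q) = frechet_derivative
        (\<lambda>q. frechet_derivative Z (at q) (W q) + christoffel q (W q) (Z q)) (at q)"
      by (rule frechet_derivative_cong_on[OF U q smooth[OF U W Z]]) (rule nabla_eq[OF U W Z])
    also have "\<dots> = (\<lambda>v. frechet_derivative (\<lambda>q. frechet_derivative Z (at q) (W q)) (at q) v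
        + frechet_derivative (\<lambda>q. christoffel q (W q) (Z q)) (at q) v)"
      by (rule frechet_derivative_at[symmetric], intro has_derivative_add smooth_on_has_derivative[OF _ q] along chr)
    finally show ?thesis
      by (simp add: along(2)[OF q] chr(2)[OF q] nabla_eq[OF U W Z q] linear_add[OF linear_christoffel_right])
  qed
  have bracket: "nabla (lie_bracket X Y) Z q
      = frechet_derivative Z (at q) (lie_bracket X Y q) + christoffel q (lie_bracket X Y q) (Z q)"
    by (rule nabla_eq[OF U smooth_on_lie_bracket[OF U X Y] Z q])
  have lin: "linear (frechet_derivative Z (at q))"
    by (rule linear_frechet_derivative_smooth_on[OF Z q])
  show ?thesis
    unfolding curvature_def second[OF X Y] second[OF Y X] bracket
    using second_derivative_symmetric[OF U q Z, of "X q" "Y q"]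
    by (simp add: lie_bracket_def linear_diff[OF lin] linear_diff[OF linear_christoffel_left] algebra_simps)
qed

end

section \<open>Connections with degenerate Christoffel symbols\<close>

lemma frechet_derivative_translate:
  assumes h: "smooth_on UNIV h" and inv: "\<And>q. h (q + n) = h q"
  shows "frechet_derivative h (at (q + n)) = frechet_derivative h (at q)"
proof -
  have "((\<lambda>x. x + n) has_derivative (\<lambda>v. v)) (at q)"
    by (auto intro!: derivative_eq_intros)
  from diff_chain_at[OF this smooth_on_has_derivative[OF h UNIV_I]]
  have "(h has_derivative frechet_derivative h (at (q + n))) (at q)"
    by (simp add: o_def inv)
  then show ?thesis by (rule frechet_derivative_at)
qed

lemma frechet_derivative_invariant:
  assumes h: "smooth_on UNIV h" and inv: "\<And>q t. h (q + t *\<^sub>R n) = h q"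
  shows "frechet_derivative h (at q) n = 0"
proof -
  have "((\<lambda>t. q + t *\<^sub>R n) has_derivative (\<lambda>s. s *\<^sub>R n)) (at 0)"
    by (auto intro!: derivative_eq_intros)
  from diff_chain_at[OF this smooth_on_has_derivative[OF h UNIV_I]]
  have "((\<lambda>t::real. h q) has_derivative (\<lambda>s. frechet_derivative h (at q) (s *\<^sub>R n))) (at 0)"
    by (simp add: o_def inv)
  from fun_cong[OF has_derivative_unique[OF this has_derivative_const], of 1] show ?thesis by simp
qed

text \<open>The kernel of \<open>P\<close> consists of the null directions: the Christoffel symbols take values in it,
  vanish on it and are constant along it. Every correction by Christoffel symbols in \<open>\<nabla>\<^sup>kR\<close> then
  drops out, and \<open>\<nabla>\<^sup>kR\<close> is an iterated directional derivative.\<close>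

locale degenerate_connection = affine_connection nabla
  for nabla :: "'c::finite vfield \<Rightarrow> 'c vfield \<Rightarrow> 'c vfield" +
  fixes P :: "real ^ 'c \<Rightarrow> real ^ 'c"
  assumes linear_P: "linear P"
    and christoffel_null: "P (christoffel q v w) = 0"
    and christoffel_null_left: "P v = 0 \<Longrightarrow> christoffel q v w = 0"
    and christoffel_null_right: "P w = 0 \<Longrightarrow> christoffel q v w = 0"
    and christoffel_translate: "P n = 0 \<Longrightarrow> christoffel (q + n) v w = christoffel q v w"
begin

text \<open>This is \<open>\<nabla>\<^sup>kR\<close> without the terms \<open>\<Gamma>(X, \<Gamma>(Y, Z))\<close> of the curvature and without the corrections of
  the covariant derivative, all of which vanish for a degenerate connection. The list is arranged as
  in \<^const>\<open>nabla_curvature\<close>.\<close>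

primrec curvature_tensor :: "nat \<Rightarrow> real ^ 'c \<Rightarrow> (real ^ 'c) list \<Rightarrow> real ^ 'c" where
  "curvature_tensor 0 q vs = frechet_derivative (\<lambda>x. christoffel x (vs ! 1) (vs ! 2)) (at q) (vs ! 0)
     - frechet_derivative (\<lambda>x. christoffel x (vs ! 0) (vs ! 2)) (at q) (vs ! 1)"
| "curvature_tensor (Suc k) q vs = frechet_derivative (\<lambda>x. curvature_tensor k x (tl vs)) (at q) (hd vs)"

lemma smooth_tensor_curvature_tensor: "smooth_tensor UNIV (k + 3) (curvature_tensor k)"
proof (induction k)
  case 0
  have T: "smooth_tensor UNIV 2 (\<lambda>q vs. frechet_derivative (\<lambda>x. christoffel x (vs ! 0) (vs ! 1)) (at q) w)" for w
    by (rule smooth_tensor_frechet_derivative[OF open_UNIV smooth_tensor_christoffel])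
  have "linear (\<lambda>v. frechet_derivative (\<lambda>x. christoffel x v u) (at q) w)
      \<and> linear (\<lambda>u. frechet_derivative (\<lambda>x. christoffel x v u) (at q) w)" for q v u w
    using T[of w, unfolded numeral_2_eq_2, simplified, THEN conjunct1, rule_format, of "[u]" q]
      T[of w, unfolded numeral_2_eq_2, simplified, THEN conjunct2] by simp
  moreover have "linear (\<lambda>w. frechet_derivative (\<lambda>x. christoffel x v u) (at q) w)" for q v u
    using linear_frechet_derivative_smooth_on[OF smooth_on_christoffel UNIV_I] by simp
  ultimately have lin: "linear (\<lambda>v. frechet_derivative (\<lambda>x. christoffel x v u) (at q) w)"
    "linear (\<lambda>u. frechet_derivative (\<lambda>x. christoffel x v u) (at q) w)"
    "linear (\<lambda>w. frechet_derivative (\<lambda>x. christoffel x v u) (at q) w)" for q v u w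
    by blast+
  show ?case
    using lin smooth_on_frechet_derivative[OF smooth_on_christoffel]
    by (simp add: numeral_3_eq_3 numeral_2_eq_2 linear_compose_sub smooth_on_diff)
next
  case (Suc k)
  then show ?case using smooth_tensor_Suc_frechet_derivative[OF open_UNIV Suc] by simp
qed

lemma smooth_on_curvature_tensor:
  "length vs = k + 3 \<Longrightarrow> smooth_on UNIV (\<lambda>q. curvature_tensor k q vs)"
  using smooth_tensor_smooth_on[OF smooth_tensor_curvature_tensor] .

lemma P_frechet_derivative:
  assumes "smooth_on UNIV h" "\<And>q. P (h q) = 0"
  shows "P (frechet_derivative h (at q) v) = 0"
proof -
  have "((\<lambda>x. P (h x)) has_derivative (\<lambda>v. P (frechet_derivative h (at q) v))) (at q)"
    using bounded_linear.has_derivative[OF linear_conv_bounded_linear[THEN iffD1, OF linear_P]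
        smooth_on_has_derivative[OF assms(1) UNIV_I]] .
  then have "((\<lambda>x. 0) has_derivative (\<lambda>v. P (frechet_derivative h (at q) v))) (at q)"
    by (simp add: assms(2))
  from fun_cong[OF has_derivative_unique[OF this has_derivative_const], of v] show ?thesis by simp
qed

lemma curvature_tensor_null:
  "length vs = k + 3 \<Longrightarrow> P (curvature_tensor k q vs) = 0"
proof (induction k arbitrary: q vs)
  case 0
  then show ?case
    by (simp add: linear_diff[OF linear_P] P_frechet_derivative smooth_on_christoffel christoffel_null)
next
  case (Suc k)
  then show ?case by (simp add: P_frechet_derivative smooth_on_curvature_tensor)
qed

lemma curvature_tensor_translate:
  "P n = 0 \<Longrightarrow> length vs = k + 3 \<Longrightarrow> curvature_tensor k (q + n) vs = curvature_tensor k q vs"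
proof (induction k arbitrary: q vs)
  case 0
  then show ?case
    by (simp add: frechet_derivative_translate[OF smooth_on_christoffel christoffel_translate])
next
  case (Suc k)
  then show ?case
    by (simp add: frechet_derivative_translate[OF smooth_on_curvature_tensor])
qed

lemma P_scaleR: "P n = 0 \<Longrightarrow> P (t *\<^sub>R n) = 0"
  by (simp add: linear_cmul[OF linear_P])

lemma curvature_tensor_null_argument:
  "length vs = k + 3 \<Longrightarrow> v \<in> set vs \<Longrightarrow> P v = 0 \<Longrightarrow> curvature_tensor k q vs = 0"
proof (induction k arbitrary: q vs)
  case 0
  then obtain a b c where vs: "vs = [a, b, c]"
    by (auto simp: numeral_3_eq_3 length_Suc_conv)
  have inv: "frechet_derivative (\<lambda>x. christoffel x w u) (at q) n = 0" if "P n = 0" for w u n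
    by (rule frechet_derivative_invariant[OF smooth_on_christoffel christoffel_translate[OF P_scaleR[OF that]]])
  show ?case
    using 0 by (auto simp: vs inv christoffel_null_left christoffel_null_right)
next
  case (Suc k)
  obtain a ws where vs: "vs = a # ws" "length ws = k + 3"
    using Suc.prems(1) by (cases vs) auto
  show ?case
  proof (cases "v \<in> set ws")
    case True
    then show ?thesis using Suc vs by simp
  next
    case False
    then have "P a = 0" using Suc.prems vs by auto
    then show ?thesis
      using frechet_derivative_invariant[OF smooth_on_curvature_tensor[OF vs(2)]
          curvature_tensor_translate[OF P_scaleR vs(2)]]
      by (simp add: vs)
  qed
qed

text \<open>The Leibniz rule for \<open>curvature_tensor\<close> produces the terms with \<open>DX\<^sub>j(V)\<close>. In the definition of the
  covariant derivative they meet the terms with \<open>\<nabla>\<^sub>V X\<^sub>j = DX\<^sub>j(V) + \<Gamma>(V, X\<^sub>j)\<close>, whose second part is null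
  and so is killed.\<close>

theorem nabla_curvature_eq:
  assumes U: "open U"
  shows "length Xs = k + 3 \<Longrightarrow> (\<And>X. X \<in> set Xs \<Longrightarrow> smooth_on U X) \<Longrightarrow> q \<in> U \<Longrightarrow>
    nabla_curvature nabla k Xs q = curvature_tensor k q (map (\<lambda>X. X q) Xs)"
proof (induction k arbitrary: Xs q)
  case 0
  then obtain X Y Z where Xs: "Xs = [X, Y, Z]"
    by (auto simp: numeral_3_eq_3 length_Suc_conv)
  then show ?case
    using 0 curvature_eq[OF U, of X Y Z q]
    by (simp add: numeral_2_eq_2 christoffel_null_right[OF christoffel_null])
next
  case (Suc k)
  obtain V Ys where Xs: "Xs = V # Ys" and len: "length Ys = k + 3"
    using Suc.prems(1) by (cases Xs) auto
  have V: "smooth_on U V" and Ys: "\<And>Y. Y \<in> set Ys \<Longrightarrow> smooth_on U Y"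
    using Suc.prems Xs by auto
  note T = smooth_tensor_mono[OF smooth_tensor_curvature_tensor subset_UNIV, of U k]
  let ?ys = "map (\<lambda>X. X q) Ys"
  let ?C = "\<lambda>q. curvature_tensor k q (map (\<lambda>X. X q) Ys)"
  have eq: "?C x = nabla_curvature nabla k Ys x" if "x \<in> U" for x
    using Suc.IH[OF len Ys that] by simp
  have leibniz: "smooth_on U ?C"
    "\<And>v. frechet_derivative ?C (at q) v = frechet_derivative (\<lambda>x. curvature_tensor k x ?ys) (at q) v
      + (\<Sum>j<length Ys. curvature_tensor k q (?ys[j := frechet_derivative (Ys ! j) (at q) v]))"
    using smooth_tensor_leibniz[OF U T len Ys] Suc.prems(3) len by auto
  have "nabla V (nabla_curvature nabla k Ys) q = nabla V ?C q"
    by (rule local[OF U V leibniz(1)]) (use Suc.prems eq in auto)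
  also have "\<dots> = frechet_derivative ?C (at q) (V q)"
    using nabla_eq[OF U V leibniz(1) Suc.prems(3)]
      christoffel_null_right[OF curvature_tensor_null, of ?ys k] len by simp
  finally have outer: "nabla V (nabla_curvature nabla k Ys) q = frechet_derivative ?C (at q) (V q)" .
  have inner: "nabla_curvature nabla k (Ys[j := nabla V (Ys ! j)]) q
      = curvature_tensor k q (?ys[j := frechet_derivative (Ys ! j) (at q) (V q)])"
    if j: "j < length Ys" for j
  proof -
    have Yj: "smooth_on U (Ys ! j)" using Ys j by simp
    let ?G = "christoffel q (V q) ((Ys ! j) q)"
    have "nabla_curvature nabla k (Ys[j := nabla V (Ys ! j)]) q
        = curvature_tensor k q (?ys[j := nabla V (Ys ! j) q])"
    proof (subst Suc.IH)
      show "smooth_on U X" if "X \<in> set (Ys[j := nabla V (Ys ! j)])" for X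
        using that Ys smooth[OF U V Yj] set_update_subset_insert by fastforce
    qed (use len Suc.prems in \<open>simp_all add: map_update\<close>)
    also have "\<dots> = curvature_tensor k q (?ys[j := frechet_derivative (Ys ! j) (at q) (V q)])
        + curvature_tensor k q (?ys[j := ?G])"
      unfolding nabla_eq[OF U V Yj Suc.prems(3)]
      by (rule smooth_tensor_update_add[OF smooth_tensor_curvature_tensor]) (use len j in auto)
    also have "curvature_tensor k q (?ys[j := ?G]) = 0"
      by (rule curvature_tensor_null_argument[where v = ?G])
        (use len j in \<open>auto simp: christoffel_null set_update_memI\<close>)
    finally show ?thesis by simp
  qed
  show ?case
    by (simp add: Xs outer leibniz(2) inner)
qed

corollary nabla_curvature_at_eq:
  "length vs = k + 3 \<Longrightarrow> nabla_curvature_at nabla k q vs = curvature_tensor k q vs"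
  unfolding nabla_curvature_at_def
  by (subst nabla_curvature_eq[OF open_UNIV]) (auto simp: smooth_on_const o_def)

lemma smooth_on_nabla_curvature:
  assumes "open U" "length Xs = k + 3" "\<And>X. X \<in> set Xs \<Longrightarrow> smooth_on U X"
  shows "smooth_on U (nabla_curvature nabla k Xs)"
proof (rule smooth_on_cong[OF assms(1)])
  show "smooth_on U (\<lambda>q. curvature_tensor k q (map (\<lambda>X. X q) Xs))"
    using smooth_tensor_leibniz[OF assms(1)
        smooth_tensor_mono[OF smooth_tensor_curvature_tensor subset_UNIV] assms(2,3)] by simp
qed (use nabla_curvature_eq assms in metis)

lemma nabla_curvature_cong:
  assumes "open U" "length Xs = k + 3" "\<And>X. X \<in> set Xs \<Longrightarrow> smooth_on U X"
    "length Ys = k + 3" "\<And>Y. Y \<in> set Ys \<Longrightarrow> smooth_on U Y"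
    "q \<in> U" "map (\<lambda>X. X q) Xs = map (\<lambda>Y. Y q) Ys"
  shows "nabla_curvature nabla k Xs q = nabla_curvature nabla k Ys q"
  using nabla_curvature_eq assms by metis

end

section \<open>Naturality of the curvature\<close>

locale connection_preserving_map = degenerate_connection nabla P + torsion_free_connection nabla
  for nabla :: "'c::finite vfield \<Rightarrow> 'c vfield \<Rightarrow> 'c vfield" and P :: "real ^ 'c \<Rightarrow> real ^ 'c" +
  fixes U V :: "(real ^ 'c) set" and \<phi> :: "real ^ 'c \<Rightarrow> real ^ 'c"
  assumes diffeo: "diffeomorphism_between U V \<phi>"
    and preserves: "preserves_connection U \<phi> nabla"
begin

abbreviation "\<psi> \<equiv> the_inv_into U \<phi>"
abbreviation "push \<equiv> push_forward \<phi> \<psi>"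

lemma open_U: "open U" and open_V: "open V"
  and smooth_phi: "smooth_on U \<phi>" and smooth_psi: "smooth_on V \<psi>"
  and inj_phi: "inj_on \<phi> U" and image_phi: "\<phi> ` U = V"
  using diffeo by (auto simp: diffeomorphism_between_def bij_betw_def)

lemma psi_phi: "q \<in> U \<Longrightarrow> \<psi> (\<phi> q) = q"
  using the_inv_into_f_f[OF inj_phi] .

lemma phi_psi: "q \<in> V \<Longrightarrow> \<phi> (\<psi> q) = q" and psi_in: "q \<in> V \<Longrightarrow> \<psi> q \<in> U"
  using f_the_inv_into_f[OF inj_phi] the_inv_into_into[OF inj_phi _ subset_refl] image_phi by auto

lemma phi_in: "q \<in> U \<Longrightarrow> \<phi> q \<in> V"
  using image_phi by blast

lemma derivative_phi_psi:
  assumes "q \<in> U"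
  shows "frechet_derivative \<phi> (at q) (frechet_derivative \<psi> (at (\<phi> q)) v) = v"
proof -
  have "frechet_derivative (\<lambda>x. \<phi> (\<psi> x)) (at (\<phi> q))
      = (\<lambda>v. frechet_derivative \<phi> (at q) (frechet_derivative \<psi> (at (\<phi> q)) v))"
    using diff_chain_at[OF smooth_on_has_derivative[OF smooth_psi phi_in[OF assms]]
        smooth_on_has_derivative[OF smooth_phi psi_in[OF phi_in[OF assms]]]]
    by (simp add: o_def psi_phi[OF assms] frechet_derivative_at[symmetric])
  moreover have "frechet_derivative (\<lambda>x. x) (at (\<phi> q)) = frechet_derivative (\<lambda>x. \<phi> (\<psi> x)) (at (\<phi> q))"
    by (rule frechet_derivative_cong_on[OF open_V phi_in[OF assms] smooth_on_ident]) (simp add: phi_psi)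
  ultimately show ?thesis by (metis frechet_derivative_ident)
qed

lemma derivative_psi_phi:
  assumes "q \<in> U"
  shows "frechet_derivative \<psi> (at (\<phi> q)) (frechet_derivative \<phi> (at q) v) = v"
proof -
  have "frechet_derivative (\<lambda>x. \<psi> (\<phi> x)) (at q)
      = (\<lambda>v. frechet_derivative \<psi> (at (\<phi> q)) (frechet_derivative \<phi> (at q) v))"
    using diff_chain_at[OF smooth_on_has_derivative[OF smooth_phi assms]
        smooth_on_has_derivative[OF smooth_psi phi_in[OF assms]]]
    by (simp add: o_def frechet_derivative_at[symmetric])
  moreover have "frechet_derivative (\<lambda>x. x) (at q) = frechet_derivative (\<lambda>x. \<psi> (\<phi> x)) (at q)"
    by (rule frechet_derivative_cong_on[OF open_U assms smooth_on_ident]) (simp add: psi_phi)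
  ultimately show ?thesis by (metis frechet_derivative_ident)
qed

lemma linear_derivative_phi: "q \<in> U \<Longrightarrow> linear (frechet_derivative \<phi> (at q))"
  using linear_frechet_derivative_smooth_on[OF smooth_phi] .

lemma smooth_on_push: "smooth_on U X \<Longrightarrow> smooth_on V (push X)"
  unfolding push_forward_def
  by (rule smooth_on_compose[OF open_V smooth_psi _
        smooth_on_frechet_derivative_along(1)[OF open_U smooth_phi]]) (auto intro: psi_in)

lemma nabla_push:
  assumes "smooth_on U X" "smooth_on U Y" "q \<in> V"
  shows "nabla (push X) (push Y) q = push (nabla X Y) q"
proof -
  let ?p = "\<psi> q"
  have "push_forward \<psi> \<phi> (nabla (push X) (push Y)) ?p = nabla X Y ?p"
    using preserves assms psi_in[OF assms(3)]
    by (simp add: preserves_connection_def pull_back_connection_def Let_def)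
  then have "frechet_derivative \<phi> (at ?p) (frechet_derivative \<psi> (at (\<phi> ?p)) (nabla (push X) (push Y) (\<phi> ?p)))
      = frechet_derivative \<phi> (at ?p) (nabla X Y ?p)"
    by (simp add: push_forward_def)
  then show ?thesis
    using derivative_phi_psi[OF psi_in[OF assms(3)]] phi_psi[OF assms(3)] by (simp add: push_forward_def)
qed

lemma push_diff: "q \<in> V \<Longrightarrow> push (\<lambda>q. X q - Y q) q = push X q - push Y q"
  unfolding push_forward_def by (simp add: linear_diff[OF linear_derivative_phi[OF psi_in]])

lemma push_sum: "q \<in> V \<Longrightarrow> push (\<lambda>q. \<Sum>j\<in>I. X j q) q = (\<Sum>j\<in>I. push (X j) q)"
  unfolding push_forward_def by (simp add: linear_sum[OF linear_derivative_phi[OF psi_in]])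

text \<open>The bracket is natural because it is the antisymmetric part of a torsion-free connection.\<close>

lemma lie_bracket_push:
  assumes "smooth_on U X" "smooth_on U Y" "q \<in> V"
  shows "lie_bracket (push X) (push Y) q = push (lie_bracket X Y) q"
proof -
  have "lie_bracket (push X) (push Y) q = nabla (push X) (push Y) q - nabla (push Y) (push X) q"
    using torsion_free[OF open_V smooth_on_push smooth_on_push assms(3)] assms by simp
  also have "\<dots> = push (\<lambda>q. nabla X Y q - nabla Y X q) q"
    using assms by (simp add: nabla_push push_diff)
  also have "\<dots> = push (lie_bracket X Y) q"
    unfolding push_forward_def
    using torsion_free[OF open_U assms(1,2) psi_in[OF assms(3)]] by simp
  finally show ?thesis .
qed

lemma nabla_nabla_push:
  assumes X: "smooth_on U X" and W: "smooth_on U W"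
    and eq: "\<And>q. q \<in> V \<Longrightarrow> W' q = push W q" and q: "q \<in> V"
  shows "nabla (push X) W' q = push (nabla X W) q"
proof -
  have "nabla (push X) W' q = nabla (push X) (push W) q"
    by (rule local[OF open_V smooth_on_push[OF X] smooth_on_push[OF W] refl eq q])
  then show ?thesis using nabla_push[OF X W q] by simp
qed

text \<open>All fields have to be admitted here, not only the constant ones: the inductive step replaces
  arguments by their covariant derivatives.\<close>

theorem nabla_curvature_push:
  "length Xs = k + 3 \<Longrightarrow> (\<And>X. X \<in> set Xs \<Longrightarrow> smooth_on U X) \<Longrightarrow> q \<in> V \<Longrightarrow>
    nabla_curvature nabla k (map push Xs) q = push (nabla_curvature nabla k Xs) q"
proof (induction k arbitrary: Xs q)
  case 0
  then obtain X Y Z where Xs: "Xs = [X, Y, Z]"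
    by (auto simp: numeral_3_eq_3 length_Suc_conv)
  have X: "smooth_on U X" and Y: "smooth_on U Y" and Z: "smooth_on U Z"
    using 0 Xs by auto
  have "nabla (lie_bracket (push X) (push Y)) (push Z) q = nabla (push (lie_bracket X Y)) (push Z) q"
    by (rule local[OF open_V smooth_on_push[OF smooth_on_lie_bracket[OF open_U X Y]] smooth_on_push[OF Z]
          lie_bracket_push[OF X Y] refl \<open>q \<in> V\<close>])
  also have "\<dots> = push (nabla (lie_bracket X Y) Z) q"
    by (rule nabla_push[OF smooth_on_lie_bracket[OF open_U X Y] Z \<open>q \<in> V\<close>])
  finally show ?case
    using nabla_nabla_push[OF X smooth[OF open_U Y Z] nabla_push[OF Y Z] \<open>q \<in> V\<close>]
      nabla_nabla_push[OF Y smooth[OF open_U X Z] nabla_push[OF X Z] \<open>q \<in> V\<close>]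
    by (simp add: Xs numeral_2_eq_2 curvature_def push_diff[OF \<open>q \<in> V\<close>])
next
  case (Suc k)
  obtain X Ys where Xs: "Xs = X # Ys" and len: "length Ys = k + 3"
    using Suc.prems(1) by (cases Xs) auto
  have X: "smooth_on U X" and Ys: "\<And>Y. Y \<in> set Ys \<Longrightarrow> smooth_on U Y"
    using Suc.prems Xs by auto
  have q: "q \<in> V" by fact
  have outer: "nabla (push X) (nabla_curvature nabla k (map push Ys)) q
      = push (nabla X (nabla_curvature nabla k Ys)) q"
    by (rule nabla_nabla_push[OF X smooth_on_nabla_curvature[OF open_U len Ys] Suc.IH[OF len Ys] q])
  have inner: "nabla_curvature nabla k ((map push Ys)[j := nabla (push X) (push (Ys ! j))]) q
      = push (nabla_curvature nabla k (Ys[j := nabla X (Ys ! j)])) q" if j: "j < length Ys" for j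
  proof -
    have Yj: "smooth_on U (Ys ! j)" using Ys j by simp
    have upd: "smooth_on U Y" if "Y \<in> set (Ys[j := nabla X (Ys ! j)])" for Y
      using that Ys smooth[OF open_U X Yj] set_update_subset_insert by fastforce
    have upd': "smooth_on V Y" if "Y \<in> set ((map push Ys)[j := nabla (push X) (push (Ys ! j))])" for Y
      using that Ys smooth[OF open_V smooth_on_push[OF X] smooth_on_push[OF Yj]]
        set_update_subset_insert smooth_on_push by fastforce
    have push_upd: "smooth_on V Y" if "Y \<in> set (map push (Ys[j := nabla X (Ys ! j)]))" for Y
      using that upd smooth_on_push unfolding set_map by blast
    have "nabla_curvature nabla k ((map push Ys)[j := nabla (push X) (push (Ys ! j))]) q
        = nabla_curvature nabla k (map push (Ys[j := nabla X (Ys ! j)])) q"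
      by (rule nabla_curvature_cong[OF open_V _ upd' _ push_upd q])
        (use len upd smooth_on_push nabla_push[OF X Yj q] in \<open>auto simp: map_update o_def\<close>)
    also have "\<dots> = push (nabla_curvature nabla k (Ys[j := nabla X (Ys ! j)])) q"
      by (rule Suc.IH) (use len upd q in auto)
    finally show ?thesis .
  qed
  show ?case
    by (simp add: Xs outer inner push_diff[OF q] push_sum[OF q])
qed

theorem curvature_tensor_intertwines:
  assumes "q \<in> U" "length vs = k + 3"
  shows "curvature_tensor k (\<phi> q) (map (frechet_derivative \<phi> (at q)) vs)
    = frechet_derivative \<phi> (at q) (curvature_tensor k q vs)"
proof -
  let ?Xs = "map (\<lambda>v _. v) vs"
  have sm: "\<And>X. X \<in> set ?Xs \<Longrightarrow> smooth_on U X" by (auto simp: smooth_on_const)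
  have "nabla_curvature nabla k (map push ?Xs) (\<phi> q) = push (nabla_curvature nabla k ?Xs) (\<phi> q)"
    using assms by (intro nabla_curvature_push sm phi_in) auto
  moreover have "nabla_curvature nabla k (map push ?Xs) (\<phi> q)
      = curvature_tensor k (\<phi> q) (map (\<lambda>X. X (\<phi> q)) (map push ?Xs))"
    by (rule nabla_curvature_eq[OF open_V]) (use assms smooth_on_push smooth_on_const phi_in in auto)
  moreover have "nabla_curvature nabla k ?Xs q = curvature_tensor k q (map (\<lambda>X. X q) ?Xs)"
    by (rule nabla_curvature_eq[OF open_U]) (use assms sm in auto)
  ultimately show ?thesis
    using psi_phi[OF assms(1)] by (simp add: push_forward_def o_def)
qed

end

section \<open>Iterated directional derivatives\<close>

text \<open>As in the lists of arguments of \<open>\<nabla>\<^sup>kR\<close>, the head is the direction of the last differentiation.\<close>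

primrec iterated_derivative ::
  "('a::real_normed_vector \<Rightarrow> 'b::real_normed_vector) \<Rightarrow> 'a list \<Rightarrow> 'a \<Rightarrow> 'b" where
  "iterated_derivative h [] = h"
| "iterated_derivative h (v # vs) = (\<lambda>q. frechet_derivative (iterated_derivative h vs) (at q) v)"

lemma smooth_on_iterated_derivative:
  "smooth_on U h \<Longrightarrow> smooth_on U (iterated_derivative h vs)"
  by (induction vs) (simp_all add: smooth_on_frechet_derivative)

lemma iterated_derivative_append:
  "iterated_derivative h (vs @ ws) = iterated_derivative (iterated_derivative h ws) vs"
  by (induction vs) simp_all

lemma iterated_derivative_linear_combination:
  fixes h1 h2 :: "'a::real_normed_vector \<Rightarrow> 'b::real_normed_vector"
  assumes "smooth_on UNIV h1" "smooth_on UNIV h2"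
  shows "iterated_derivative (\<lambda>q. a *\<^sub>R h1 q + b *\<^sub>R h2 q) vs
    = (\<lambda>q. a *\<^sub>R iterated_derivative h1 vs q + b *\<^sub>R iterated_derivative h2 vs q)"
proof (induction vs)
  case (Cons v vs)
  let ?D = "\<lambda>h. iterated_derivative h vs"
  have "((\<lambda>q. a *\<^sub>R ?D h1 q + b *\<^sub>R ?D h2 q) has_derivative
      (\<lambda>v. a *\<^sub>R frechet_derivative (?D h1) (at q) v + b *\<^sub>R frechet_derivative (?D h2) (at q) v)) (at q)" for q
    by (intro has_derivative_add has_derivative_scaleR_right
        smooth_on_has_derivative[OF smooth_on_iterated_derivative[OF assms(1)] UNIV_I]
        smooth_on_has_derivative[OF smooth_on_iterated_derivative[OF assms(2)] UNIV_I])
  from frechet_derivative_at[OF this, symmetric] show ?case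
    by (simp add: Cons)
qed simp

lemma iterated_derivative_scale:
  fixes h :: "'a::real_normed_vector \<Rightarrow> real"
  assumes "smooth_on UNIV h"
  shows "iterated_derivative (\<lambda>q. a * h q) vs = (\<lambda>q. a * iterated_derivative h vs q)"
  using iterated_derivative_linear_combination[OF assms assms, of a 0] by simp

lemma iterated_derivative_vec_nth:
  assumes "smooth_on UNIV h"
  shows "iterated_derivative (\<lambda>q. h q $ c) vs = (\<lambda>q. iterated_derivative h vs q $ c)"
proof (induction vs)
  case (Cons v vs)
  show ?case
    unfolding iterated_derivative.simps Cons
    by (rule ext, rule frechet_derivative_vec_nth,
        rule smooth_on_differentiable[OF smooth_on_iterated_derivative[OF assms] UNIV_I])
qed simp

text \<open>The innermost derivative is taken along \<open>X\<close> or \<open>Y\<close>; the directions \<open>Vs\<close> come after it.\<close>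

lemma (in degenerate_connection) curvature_tensor_eq_iterated_derivative:
  "length Vs = k \<Longrightarrow> curvature_tensor k q (Vs @ [X, Y, Z])
    = iterated_derivative (\<lambda>x. christoffel x Y Z) (Vs @ [X]) q
    - iterated_derivative (\<lambda>x. christoffel x X Z) (Vs @ [Y]) q"
proof (induction k arbitrary: Vs q)
  case (Suc k)
  then obtain V Ws where Vs: "Vs = V # Ws" "length Ws = k" by (cases Vs) auto
  have "frechet_derivative (\<lambda>x. iterated_derivative (\<lambda>x. christoffel x Y Z) (Ws @ [X]) x
        - iterated_derivative (\<lambda>x. christoffel x X Z) (Ws @ [Y]) x) (at q)
      = (\<lambda>v. frechet_derivative (iterated_derivative (\<lambda>x. christoffel x Y Z) (Ws @ [X])) (at q) v
        - frechet_derivative (iterated_derivative (\<lambda>x. christoffel x X Z) (Ws @ [Y])) (at q) v)"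
    by (rule frechet_derivative_at[symmetric], intro has_derivative_diff
        smooth_on_has_derivative[OF smooth_on_iterated_derivative[OF smooth_on_christoffel] UNIV_I])
  then show ?case by (simp add: Vs Suc.IH)
qed simp

lemma has_real_derivative_smooth_on:
  fixes f :: "real \<Rightarrow> real"
  assumes "smooth_on UNIV f"
  shows "(f has_real_derivative frechet_derivative f (at t) 1) (at t)"
proof -
  have eq: "frechet_derivative f (at t) 1 * v = frechet_derivative f (at t) v" for v
    using linear_cmul[OF linear_frechet_derivative_smooth_on[OF assms UNIV_I, of t], of v 1]
    by (simp add: mult.commute)
  then have "(*) (frechet_derivative f (at t) 1) = frechet_derivative f (at t)"
    by (intro ext) (rule eq)
  then show ?thesis
    using smooth_on_has_derivative[OF assms UNIV_I, of t] by (simp add: has_field_derivative_def)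
qed

lemma smooth_on_higher_deriv:
  fixes f :: "real \<Rightarrow> real"
  assumes "smooth_on UNIV f"
  shows "smooth_on UNIV ((deriv ^^ m) f)"
proof (induction m)
  case (Suc m)
  have "deriv ((deriv ^^ m) f) = (\<lambda>t. frechet_derivative ((deriv ^^ m) f) (at t) 1)"
    using DERIV_imp_deriv[OF has_real_derivative_smooth_on[OF Suc]] by blast
  then show ?case using smooth_on_frechet_derivative[OF Suc] by simp
qed (simp add: assms)

lemma higher_deriv_has_real_derivative:
  fixes f :: "real \<Rightarrow> real"
  assumes "smooth_on UNIV f"
  shows "((deriv ^^ m) f has_real_derivative (deriv ^^ Suc m) f t) (at t)"
  using has_real_derivative_smooth_on[OF smooth_on_higher_deriv[OF assms], of m t]
    DERIV_imp_deriv by fastforce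

section \<open>The metric\<close>

primrec barred :: "'n coord \<Rightarrow> bool" where
  "barred Cx = False"
| "barred Cy = False"
| "barred (Cz a) = False"
| "barred Cxbar = True"
| "barred Cybar = True"
| "barred (Czbar a) = True"

primrec partner :: "'n coord \<Rightarrow> 'n coord" where
  "partner Cx = Cxbar"
| "partner Cy = Cybar"
| "partner (Cz a) = Czbar a"
| "partner Cxbar = Cx"
| "partner Cybar = Cy"
| "partner (Czbar a) = Cz a"

lemma partner_partner [simp]: "partner (partner c) = c"
  by (cases c) simp_all

lemma barred_partner [simp]: "barred (partner c) \<longleftrightarrow> \<not> barred c"
  by (cases c) simp_all

lemma metric_component_eq:
  "metric_component F i j = (if j = partner i then 1 else 0) + (if i = Cx \<and> j = Cx then - 2 * F else 0)"
  unfolding metric_component_def by (cases i; cases j) (auto simp: doubleton_eq_iff)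

lemma metric_inner_g_metric:
  "metric_inner (g_metric p e f) q v w
    = (\<Sum>i\<in>UNIV. v $ i * w $ partner i) - 2 * F_fun p e f q * v $ Cx * w $ Cx"
proof -
  let ?F = "F_fun p e f q"
  have row: "(\<Sum>j\<in>UNIV. metric_component ?F i j * w $ j)
      = w $ partner i + (if i = Cx then - 2 * ?F * w $ Cx else 0)" for i
  proof -
    have "(\<Sum>j\<in>UNIV. metric_component ?F i j * w $ j)
        = (\<Sum>j\<in>UNIV. if j = partner i then w $ j else 0)
          + (\<Sum>j\<in>UNIV. if j = Cx then (if i = Cx then - 2 * ?F * w $ j else 0) else 0)"
      unfolding sum.distrib[symmetric] metric_component_eq by (rule sum.cong) auto
    then show ?thesis by (simp add: sum.delta)
  qed
  have "metric_inner (g_metric p e f) q v w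
      = (\<Sum>i\<in>UNIV. v $ i * (w $ partner i + (if i = Cx then - 2 * ?F * w $ Cx else 0)))"
    by (simp add: metric_inner_def inner_vec_def matrix_vector_mult_def g_metric_def row)
  also have "\<dots> = (\<Sum>i\<in>UNIV. v $ i * w $ partner i)
      + (\<Sum>i\<in>UNIV. if i = Cx then - 2 * ?F * v $ i * w $ Cx else 0)"
    unfolding sum.distrib[symmetric] by (rule sum.cong) (auto simp: algebra_simps)
  finally show ?thesis by (simp add: sum.delta)
qed

lemma metric_inner_axis:
  "metric_inner (g_metric p e f) q v (axis i 1)
    = v $ partner i - (if i = Cx then 2 * F_fun p e f q * v $ Cx else 0)"
proof -
  have "(\<Sum>j\<in>UNIV. v $ j * axis i 1 $ partner j) = (\<Sum>j\<in>UNIV. if j = partner i then v $ j else 0)"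
    by (rule sum.cong) (auto simp: axis_def dest: arg_cong[of _ _ partner])
  then show ?thesis
    by (auto simp: metric_inner_g_metric axis_def sum.delta)
qed

lemma metric_inner_commute:
  "metric_inner (g_metric p e f) q v w = metric_inner (g_metric p e f) q w v"
proof -
  have "(\<Sum>i\<in>UNIV. v $ i * w $ partner i) = (\<Sum>i\<in>UNIV. w $ i * v $ partner i)"
    by (rule sum.reindex_bij_witness[of _ partner partner]) (auto simp: mult.commute)
  then show ?thesis by (simp add: metric_inner_g_metric)
qed

text \<open>The inverse matrix pairs partners with each other and has the further entry \<open>2F\<close> at the barred
  position opposite to the entry \<open>-2F\<close> of the metric.\<close>

lemma matrix_inv_g_metric_unbarred:
  assumes "\<not> barred i" "\<not> barred j"
  shows "matrix_inv (g_metric p e f q) $ i $ j = 0"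
proof -
  let ?F = "F_fun p e f q"
  define G :: "real ^ 'a coord ^ 'a coord" where
    "G = (\<chi> i j. (if j = partner i then 1 else 0) + (if i = Cxbar \<and> j = Cxbar then 2 * ?F else 0))"
  let ?g = "g_metric p e f q"
  have "?g ** G = mat 1"
  proof -
    have "(\<Sum>k\<in>UNIV. ?g $ i $ k * G $ k $ j) = (if i = j then 1 else 0)" for i j
    proof -
      have "(\<Sum>k\<in>UNIV. ?g $ i $ k * G $ k $ j)
          = (\<Sum>k\<in>UNIV. (if k = partner i then G $ k $ j else 0)
            + (if k = Cx then (if i = Cx then - 2 * ?F * G $ k $ j else 0) else 0))"
        by (rule sum.cong) (auto simp: g_metric_def metric_component_eq algebra_simps)
      also have "\<dots> = G $ partner i $ j + (if i = Cx then - 2 * ?F * G $ Cx $ j else 0)"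
        by (simp add: sum.distrib sum.delta)
      also have "\<dots> = (if i = j then 1 else 0)"
        by (cases i; cases j) (simp_all add: G_def)
      finally show ?thesis .
    qed
    then show ?thesis by (simp add: vec_eq_iff matrix_matrix_mult_def mat_def)
  qed
  then have "G ** ?g = mat 1" by (simp add: matrix_left_right_inverse)
  moreover have "?g ** matrix_inv ?g = mat 1"
    unfolding matrix_inv_def
    by (rule someI2[of _ G]) (use \<open>?g ** G = mat 1\<close> \<open>G ** ?g = mat 1\<close> in auto)
  ultimately have "matrix_inv ?g = G" by (metis matrix_mul_assoc matrix_mul_lid matrix_mul_rid)
  then show ?thesis using assms by (auto simp: G_def)
qed

section \<open>The Levi-Civita connection\<close>

lemma smooth_on_F_fun:
  assumes "smooth_on UNIV f"
  shows "smooth_on UNIV (F_fun p e f)"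
  unfolding F_fun_def[abs_def]
  by (intro smooth_on_add smooth_on_sum smooth_on_mult smooth_on_power smooth_on_vec_nth smooth_on_ident
      smooth_on_compose[OF open_UNIV _ subset_UNIV assms] open_UNIV finite_atLeastAtMost)

locale generalized_plane_wave = levi_civita_connection nabla "g_metric p e f"
  for nabla :: "'n::finite coord vfield \<Rightarrow> 'n coord vfield \<Rightarrow> 'n coord vfield"
    and p :: nat and e :: "nat \<Rightarrow> 'n" and f :: "real \<Rightarrow> real" +
  assumes smooth_f: "smooth_on UNIV f"
begin

abbreviation "F \<equiv> F_fun p e f"
abbreviation "dF \<equiv> \<lambda>q. frechet_derivative F (at q)"

definition unbarred_part :: "real ^ 'n coord \<Rightarrow> real ^ 'n coord" where
  "unbarred_part v = (\<chi> c. if barred c then 0 else v $ c)"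

lemma unbarred_part_eq_0: "unbarred_part v = 0 \<longleftrightarrow> (\<forall>c. \<not> barred c \<longrightarrow> v $ c = 0)"
  by (auto simp: unbarred_part_def vec_eq_iff)

lemma smooth_F: "smooth_on UNIV F"
  by (rule smooth_on_F_fun[OF smooth_f])

lemma F_invariant: "n $ Cy = 0 \<Longrightarrow> (\<And>a. n $ Cz a = 0) \<Longrightarrow> F (q + n) = F q"
  by (simp add: F_fun_def)

lemma dF_eq_0: "n $ Cy = 0 \<Longrightarrow> (\<And>a. n $ Cz a = 0) \<Longrightarrow> dF q n = 0"
  by (rule frechet_derivative_invariant[OF smooth_F F_invariant]) auto

lemma christoffel_commute: "christoffel q v w = christoffel q w v"
  using torsion_free[OF open_UNIV smooth_on_const smooth_on_const, of q v w]
  by (simp add: christoffel_def lie_bracket_def)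

text \<open>The Koszul formula. As the frame is constant, the only contribution comes from \<open>g(\<partial>\<^sub>x, \<partial>\<^sub>x) = -2F\<close>.\<close>

lemma metric_inner_christoffel:
  "metric_inner (g_metric p e f) q (christoffel q u v) w
    = u $ Cx * v $ Cx * dF q w - v $ Cx * w $ Cx * dF q u - u $ Cx * w $ Cx * dF q v"
proof -
  let ?g = "metric_inner (g_metric p e f) q"
  have compat: "- 2 * v $ Cx * w $ Cx * dF q u
      = ?g (christoffel q u v) w + ?g v (christoffel q u w)" for u v w
  proof -
    have "((\<lambda>q. metric_inner (g_metric p e f) q v w) has_derivative
        (\<lambda>u. - 2 * v $ Cx * w $ Cx * dF q u)) (at q)"
      unfolding metric_inner_g_metric
      by (auto intro!: derivative_eq_intros smooth_on_has_derivative[OF smooth_F])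
    from frechet_derivative_at[OF this, symmetric] show ?thesis
      using metric_compatible[OF open_UNIV smooth_on_const smooth_on_const smooth_on_const, of q v w u]
      by (simp add: christoffel_def)
  qed
  show ?thesis
    using compat[of v w u] compat[of u w v] compat[of u v w] compat[of w u v] compat[of v u w]
      christoffel_commute[of q u v] christoffel_commute[of q u w] christoffel_commute[of q v w]
    by (simp add: metric_inner_commute[of p e f q u] metric_inner_commute[of p e f q v]
        metric_inner_commute[of p e f q w] algebra_simps)
qed

lemma christoffel_nth:
  "christoffel q u v $ c = (if c = Cxbar then - v $ Cx * dF q u - u $ Cx * dF q v
     else u $ Cx * v $ Cx * dF q (axis (partner c) 1))"
proof -
  have x: "christoffel q u v $ Cx = 0"
    using metric_inner_christoffel[of q u v "axis Cxbar 1"] dF_eq_0[of "axis Cxbar 1" q]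
    unfolding metric_inner_axis by (simp add: axis_def)
  have dx: "dF q (axis Cx 1) = 0" by (rule dF_eq_0) (simp_all add: axis_def)
  show ?thesis
    using metric_inner_christoffel[of q u v "axis (partner c) 1"] x dx
    by (cases c) (simp_all add: metric_inner_axis, simp_all add: axis_def)
qed

text \<open>All conditions hold because a barred vector has no \<open>x\<close>-component and \<open>F\<close> does not depend on the
  barred coordinates.\<close>

sublocale degenerate_connection nabla unbarred_part
proof (intro degenerate_connection.intro degenerate_connection_axioms.intro)
  show "affine_connection nabla" by (rule affine_connection_axioms)
  show "linear unbarred_part"
    by (rule linearI) (simp_all add: unbarred_part_def vec_eq_iff)
  show "unbarred_part (christoffel q v w) = 0" for q v w
  proof (unfold unbarred_part_eq_0, intro allI impI)
    fix c :: "'n coord" assume "\<not> barred c"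
    then show "christoffel q v w $ c = 0"
      using dF_eq_0[of "axis (partner c) 1" q] by (cases c) (simp_all add: christoffel_nth, simp_all add: axis_def)
  qed
  show left: "christoffel q v w = 0" if "unbarred_part v = 0" for q v w
    using that[unfolded unbarred_part_eq_0] dF_eq_0[of v q] by (simp add: vec_eq_iff christoffel_nth)
  show "christoffel q w v = 0" if "unbarred_part v = 0" for q v w
    using left[OF that] christoffel_commute by metis
  show "christoffel (q + n) v w = christoffel q v w" if "unbarred_part n = 0" for q n v w
    using frechet_derivative_translate[OF smooth_F F_invariant, of n q] that[unfolded unbarred_part_eq_0]
    by (simp add: vec_eq_iff christoffel_nth)
qed

section \<open>Vanishing of the scalar Weyl invariants\<close>

text \<open>A barred index in the last slot pairs an unbarred component of \<open>\<nabla>\<^sup>kR\<close>, which is zero; in any other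
  slot it inserts a null vector.\<close>

lemma nabla_curvature_component_barred:
  assumes len: "length is = k + 4" and c: "c \<in> set is" "barred c"
  shows "nabla_curvature_component (g_metric p e f) nabla k is q = 0"
proof -
  let ?vs = "map (\<lambda>i. axis i 1) (take (k + 3) is) :: (real ^ 'n coord) list"
  have vs: "length ?vs = k + 3" using len by simp
  have eq: "nabla_curvature_component (g_metric p e f) nabla k is q
      = metric_inner (g_metric p e f) q (curvature_tensor k q ?vs) (axis (is ! (k + 3)) 1)"
    unfolding nabla_curvature_component_def by (subst nabla_curvature_at_eq[OF vs]) simp
  have "is = take (k + 3) is @ [is ! (k + 3)]"
    using len take_Suc_conv_app_nth[of "k + 3" "is"] by simp
  then have "c \<in> set (take (k + 3) is) \<or> c = is ! (k + 3)"
    using c(1) by (metis Un_iff empty_iff empty_set list.simps(15) insertE set_append)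
  then show ?thesis
  proof
    assume "c \<in> set (take (k + 3) is)"
    then have "curvature_tensor k q ?vs = 0"
      by (intro curvature_tensor_null_argument[OF vs, where v = "axis c 1"])
        (use c(2) in \<open>auto simp: unbarred_part_eq_0 axis_def\<close>)
    then show ?thesis by (simp add: eq metric_inner_def)
  next
    assume "c = is ! (k + 3)"
    then show ?thesis
      using curvature_tensor_null[OF vs] c(2) by (auto simp: eq metric_inner_axis unbarred_part_eq_0)
  qed
qed

lemma tensor_product_component_barred:
  "length is = contraction_rank ks \<Longrightarrow> c \<in> set is \<Longrightarrow> barred c \<Longrightarrow>
    tensor_product_component (g_metric p e f) nabla ks is q = 0"
proof (induction ks arbitrary: "is")
  case Nil
  then show ?case by (simp add: contraction_rank_def)
next
  case (Cons k ks)
  have len: "length (take (k + 4) is) = k + 4" "length (drop (k + 4) is) = contraction_rank ks"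
    using Cons.prems(1) by (auto simp: contraction_rank_def)
  have "c \<in> set (take (k + 4) is) \<or> c \<in> set (drop (k + 4) is)"
    using Cons.prems(2) by (metis Un_iff append_take_drop_id set_append)
  then show ?case
    using nabla_curvature_component_barred[OF len(1)] Cons.IH[OF len(2)] Cons.prems(3) by auto
qed

text \<open>A summand can only survive if all its indices are unbarred; but then already its first pair of
  indices meets a zero entry of the inverse metric.\<close>

lemma complete_contraction_eq_0:
  assumes "ks \<noteq> []" "\<sigma> permutes {..<contraction_rank ks}"
  shows "complete_contraction (g_metric p e f) nabla ks \<sigma> q = 0"
  unfolding complete_contraction_def
proof (intro sum.neutral ballI, clarify)
  fix "is" :: "'n coord list"
  assume len: "length is = contraction_rank ks"
  have rank: "contraction_rank ks \<ge> 4"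
    using assms(1) by (cases ks) (auto simp: contraction_rank_def)
  let ?G = "\<lambda>j. matrix_inv (g_metric p e f q) $ (is ! \<sigma> (2 * j)) $ (is ! \<sigma> (2 * j + 1))"
  show "(\<Prod>j<contraction_rank ks div 2. ?G j) * tensor_product_component (g_metric p e f) nabla ks is q = 0"
  proof (cases "\<exists>c\<in>set is. barred c")
    case True
    then show ?thesis using tensor_product_component_barred[OF len] by auto
  next
    case False
    have "\<sigma> 0 < length is" "\<sigma> 1 < length is"
      using permutes_in_image[OF assms(2)] rank len by force+
    then have "?G 0 = 0"
      using False by (auto intro!: matrix_inv_g_metric_unbarred)
    then have "(\<Prod>j<contraction_rank ks div 2. ?G j) = 0"
      using rank by (intro prod_zero bexI[of _ 0]) auto
    then show ?thesis by simp
  qed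
qed

theorem scalar_weyl_invariant_eq_0:
  "I \<in> scalar_weyl_invariants (g_metric p e f) nabla \<Longrightarrow> I q = 0"
  by (induction arbitrary: q rule: scalar_weyl_invariants.induct) (simp_all add: complete_contraction_eq_0)

section \<open>The affine invariant\<close>

text \<open>Each derivative of \<open>F\<close> is the contribution of \<open>f\<close> plus an expression \<open>r(y) + \<Sum>\<^sub>i s\<^sub>i(y) z\<^sub>i\<close> with
  polynomials \<open>r\<close> and \<open>s\<^sub>i\<close>. A differentiation lowers the degree of the \<open>s\<^sub>i\<close> by one and feeds them into
  \<open>r\<close>, so the bound on the degree of \<open>r\<close> runs one step behind. Both bounds are expressed by vanishing
  coefficients because these remain meaningful when the polynomial is zero.\<close>

lemma iterated_derivative_F_form:
  "\<exists>r s. (\<forall>q. iterated_derivative F vs q = (deriv ^^ length vs) f (q $ Cy) * (\<Prod>v\<leftarrow>vs. v $ Cy)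
        + poly r (q $ Cy) + (\<Sum>i=0..p. poly (s i) (q $ Cy) * q $ Cz (e i)))
     \<and> (\<forall>j. p + 3 \<le> j + length vs \<longrightarrow> coeff r j = 0)
     \<and> (\<forall>i\<le>p. \<forall>j. p + 2 \<le> j + length vs \<longrightarrow> coeff (s i) j = 0)"
proof (induction vs)
  case Nil
  show ?case
    by (rule exI[of _ 0], rule exI[of _ "\<lambda>i. monom 1 (i + 1)"]) (auto simp: F_fun_def poly_monom)
next
  case (Cons v vs)
  then obtain r s where eq: "\<And>q. iterated_derivative F vs q = (deriv ^^ length vs) f (q $ Cy) * (\<Prod>v\<leftarrow>vs. v $ Cy)
        + poly r (q $ Cy) + (\<Sum>i=0..p. poly (s i) (q $ Cy) * q $ Cz (e i))"
    and r: "\<And>j. p + 3 \<le> j + length vs \<Longrightarrow> coeff r j = 0"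
    and s: "\<And>i j. i \<le> p \<Longrightarrow> p + 2 \<le> j + length vs \<Longrightarrow> coeff (s i) j = 0"
    by auto
  let ?m = "length vs"
  have along_y: "((\<lambda>q. h (q $ Cy)) has_derivative (\<lambda>u. h' (q $ Cy) * u $ Cy)) (at q)"
    if "\<And>t. (h has_real_derivative h' t) (at t)"
    for h h' :: "real \<Rightarrow> real" and q :: "real ^ 'n coord"
    using diff_chain_at[OF bounded_linear_imp_has_derivative[OF bounded_linear_vec_nth]
        that[unfolded has_field_derivative_def]] by (simp add: o_def)
  have "((\<lambda>q. (deriv ^^ ?m) f (q $ Cy) * (\<Prod>v\<leftarrow>vs. v $ Cy)
        + poly r (q $ Cy) + (\<Sum>i=0..p. poly (s i) (q $ Cy) * q $ Cz (e i))) has_derivative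
      (\<lambda>u. (deriv ^^ Suc ?m) f (q $ Cy) * u $ Cy * (\<Prod>v\<leftarrow>vs. v $ Cy) + poly (pderiv r) (q $ Cy) * u $ Cy
        + (\<Sum>i=0..p. poly (s i) (q $ Cy) * u $ Cz (e i)
          + poly (pderiv (s i)) (q $ Cy) * u $ Cy * q $ Cz (e i)))) (at q)" for q :: "real ^ 'n coord"
    by (intro has_derivative_add has_derivative_sum has_derivative_mult has_derivative_mult_left
        along_y higher_deriv_has_real_derivative smooth_f poly_DERIV
        bounded_linear_imp_has_derivative bounded_linear_vec_nth)
  from frechet_derivative_at[OF this, symmetric]
  have step: "iterated_derivative F (v # vs) q
      = (deriv ^^ Suc ?m) f (q $ Cy) * v $ Cy * (\<Prod>v\<leftarrow>vs. v $ Cy) + poly (pderiv r) (q $ Cy) * v $ Cy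
        + (\<Sum>i=0..p. poly (s i) (q $ Cy) * v $ Cz (e i)
          + poly (pderiv (s i)) (q $ Cy) * v $ Cy * q $ Cz (e i))" for q
    by (simp add: eq[abs_def])
  show ?case
  proof (intro exI conjI allI impI)
    let ?r = "smult (v $ Cy) (pderiv r) + (\<Sum>i=0..p. smult (v $ Cz (e i)) (s i))"
    let ?s = "\<lambda>i. smult (v $ Cy) (pderiv (s i))"
    show "iterated_derivative F (v # vs) q = (deriv ^^ length (v # vs)) f (q $ Cy) * (\<Prod>v\<leftarrow>v # vs. v $ Cy)
        + poly ?r (q $ Cy) + (\<Sum>i=0..p. poly (?s i) (q $ Cy) * q $ Cz (e i))" for q
      unfolding step by (simp add: poly_sum sum.distrib algebra_simps)
    show "coeff ?r j = 0" if "p + 3 \<le> j + length (v # vs)" for j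
      using that r[of "Suc j"] s[of _ j] by (simp add: coeff_sum coeff_pderiv)
    show "coeff (?s i) j = 0" if "i \<le> p" "p + 2 \<le> j + length (v # vs)" for i j
      using that s[of i "Suc j"] by (simp add: coeff_pderiv)
  qed
qed

text \<open>The bounds on the coefficients leave no polynomial terms after \<open>p + 3\<close> differentiations.\<close>

lemma iterated_derivative_F:
  assumes "p + 3 \<le> length vs"
  shows "iterated_derivative F vs q = (deriv ^^ length vs) f (q $ Cy) * (\<Prod>v\<leftarrow>vs. v $ Cy)"
proof -
  obtain r s where rs: "\<And>q. iterated_derivative F vs q = (deriv ^^ length vs) f (q $ Cy) * (\<Prod>v\<leftarrow>vs. v $ Cy)
        + poly r (q $ Cy) + (\<Sum>i=0..p. poly (s i) (q $ Cy) * q $ Cz (e i))"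
    and "\<And>j. p + 3 \<le> j + length vs \<Longrightarrow> coeff r j = 0"
    and "\<And>i j. i \<le> p \<Longrightarrow> p + 2 \<le> j + length vs \<Longrightarrow> coeff (s i) j = 0"
    using iterated_derivative_F_form by blast
  then have "r = 0" "\<And>i. i \<le> p \<Longrightarrow> s i = 0" using assms by (simp_all add: poly_eq_iff)
  then show ?thesis by (simp add: rs)
qed

text \<open>The curvature of the model with \<open>F = y\<^sup>2/2\<close>: the tensors \<open>\<nabla>\<^sup>kR\<close> of high order are multiples of its
  products with powers of \<open>dy\<close>.\<close>

definition curvature_model ::
  "real ^ 'n coord \<Rightarrow> real ^ 'n coord \<Rightarrow> real ^ 'n coord \<Rightarrow> real ^ 'n coord" where
  "curvature_model X Y Z = (X $ Cx * Y $ Cy - Y $ Cx * X $ Cy) *\<^sub>R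
     (Z $ Cy *\<^sub>R axis Cxbar 1 - Z $ Cx *\<^sub>R axis Cybar 1)"

lemma iterated_derivative_dF:
  "iterated_derivative (\<lambda>q. dF q v) ws = iterated_derivative F (ws @ [v])"
  by (simp add: iterated_derivative_append)

lemma iterated_derivative_christoffel_nth:
  "iterated_derivative (\<lambda>x. christoffel x u v) ws q $ c =
    (if c = Cxbar then - v $ Cx * iterated_derivative F (ws @ [u]) q - u $ Cx * iterated_derivative F (ws @ [v]) q
     else u $ Cx * v $ Cx * iterated_derivative F (ws @ [axis (partner c) 1]) q)"
proof -
  have sm: "smooth_on UNIV (\<lambda>q. dF q w)" for w by (rule smooth_on_frechet_derivative[OF smooth_F])
  have "iterated_derivative (\<lambda>x. christoffel x u v) ws q $ c
      = iterated_derivative (\<lambda>x. christoffel x u v $ c) ws q"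
    by (simp add: iterated_derivative_vec_nth[OF smooth_on_christoffel])
  also have "\<dots> = (if c = Cxbar then - v $ Cx * iterated_derivative F (ws @ [u]) q
      - u $ Cx * iterated_derivative F (ws @ [v]) q
     else u $ Cx * v $ Cx * iterated_derivative F (ws @ [axis (partner c) 1]) q)"
    using iterated_derivative_linear_combination[OF sm[of u] sm[of v], of "- v $ Cx" "- u $ Cx" ws]
      iterated_derivative_scale[OF sm, of "u $ Cx * v $ Cx" _ ws]
    unfolding christoffel_nth by (simp add: iterated_derivative_dF)
  finally show ?thesis .
qed

theorem curvature_tensor_high_order:
  assumes Vs: "length Vs = k" and k: "p + 1 \<le> k"
  shows "curvature_tensor k q (Vs @ [X, Y, Z])
    = ((deriv ^^ (k + 2)) f (q $ Cy) * (\<Prod>V\<leftarrow>Vs. V $ Cy)) *\<^sub>R curvature_model X Y Z"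
proof -
  have D: "iterated_derivative F (Vs @ [u, v]) q
      = (deriv ^^ (k + 2)) f (q $ Cy) * (\<Prod>V\<leftarrow>Vs. V $ Cy) * u $ Cy * v $ Cy" for u v
    using iterated_derivative_F[of "Vs @ [u, v]" q] Vs k by simp
  have ax: "axis (partner c) 1 $ Cy = (axis Cybar 1 $ c :: real)" for c :: "'n coord"
    by (cases c) (simp_all add: axis_def)
  show ?thesis
    unfolding vec_eq_iff curvature_tensor_eq_iterated_derivative[OF Vs]
    by (simp add: iterated_derivative_christoffel_nth D curvature_model_def ax)
      (auto simp: axis_def algebra_simps)
qed

text \<open>For \<open>k = p + 1, p + 2, p + 3\<close> evaluate \<open>\<nabla>\<^sup>kR\<close> at \<open>P\<close> on \<open>\<partial>\<^sub>y, \<dots>, \<partial>\<^sub>y, \<partial>\<^sub>x, \<partial>\<^sub>y, \<partial>\<^sub>x\<close>, and at \<open>Q\<close>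
  on the images of these vectors. The results are \<open>f\<^bsup>(k+2)\<^esup>(P)\<close> and \<open>f\<^bsup>(k+2)\<^esup>(Q) t\<^sup>k\<close> times vectors independent
  of \<open>k\<close>, where \<open>t\<close> is the \<open>y\<close>-component of the image of \<open>\<partial>\<^sub>y\<close>. The unknown \<open>t\<close> and the unknown
  vectors cancel in the quotient \<open>\<alpha>\<close>, which has the same weight in numerator and denominator.\<close>

lemma alpha_eq_of_intertwining:
  assumes pos: "\<And>t. (deriv ^^ (p + 3)) f t > 0" "\<And>t. (deriv ^^ (p + 4)) f t > 0"
    and L: "linear L" "inj L"
    and eq: "\<And>k vs. k \<le> p + 3 \<Longrightarrow> length vs = k + 3 \<Longrightarrow>
      curvature_tensor k Q (map L vs) = L (curvature_tensor k P vs)"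
  shows "alpha p f Q = alpha p f P"
proof -
  let ?x = "axis Cx 1 :: real ^ 'n coord" and ?y = "axis Cy 1 :: real ^ 'n coord"
  define d where "d m q = (deriv ^^ m) f (q $ Cy)" for m and q :: "real ^ 'n coord"
  define t where "t = L ?y $ Cy"
  have "curvature_model ?x ?y ?x $ Cybar \<noteq> 0" by (simp add: curvature_model_def axis_def)
  then have "L (curvature_model ?x ?y ?x) \<noteq> 0"
    using L by (metis linear_0 injD zero_index)
  \<comment> \<open>comparing a component in which this vector is non-zero leaves scalar equations\<close>
  then obtain c where c: "L (curvature_model ?x ?y ?x) $ c \<noteq> 0" by (auto simp: vec_eq_iff)
  define A where "A = L (curvature_model ?x ?y ?x) $ c"
  define B where "B = curvature_model (L ?x) (L ?y) (L ?x) $ c"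
  have main: "d (k + 2) Q * t ^ k * B = d (k + 2) P * A" if "p + 1 \<le> k" "k \<le> p + 3" for k
    using arg_cong[OF eq[of k "replicate k ?y @ [?x, ?y, ?x]"], of "\<lambda>v. v $ c"] that
    by (simp add: curvature_tensor_high_order linear_cmul[OF L(1)] A_def B_def t_def d_def
        prod_list_replicate axis_nth)
  have 1: "d (p + 3) Q * t ^ (p + 1) * B = d (p + 3) P * A"
    and 2: "d (p + 4) Q * t ^ (p + 2) * B = d (p + 4) P * A"
    and 3: "d (p + 5) Q * t ^ (p + 3) * B = d (p + 5) P * A"
    using main[of "p + 1"] main[of "p + 2"] main[of "p + 3"] by (simp_all add: add.commute eval_nat_numeral)
  have nz: "A \<noteq> 0" "d (p + 4) P > 0" "d (p + 4) Q > 0" "d (p + 3) P > 0"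
    using c pos by (auto simp: A_def d_def)
  define S where "S = t ^ (p + 1) * t ^ (p + 3) * B * B"
  have 4: "d (p + 3) Q * d (p + 5) Q * S = d (p + 3) P * d (p + 5) P * (A * A)"
    using arg_cong2[OF 1 3, of "(*)"] by (simp only: S_def mult_ac)
  have "p + 1 + (p + 3) = p + 2 + (p + 2)" by simp
  then have "t ^ (p + 1) * t ^ (p + 3) = t ^ (p + 2) * t ^ (p + 2)" by (metis power_add)
  then have "S = t ^ (p + 2) * t ^ (p + 2) * B * B" by (simp only: S_def)
  then have 5: "d (p + 4) Q * d (p + 4) Q * S = d (p + 4) P * d (p + 4) P * (A * A)"
    using arg_cong2[OF 2 2, of "(*)"] by (simp only: mult_ac)
  have S: "S \<noteq> 0" using 5 nz by auto
  have "d (p + 3) Q * d (p + 5) Q / (d (p + 4) Q * d (p + 4) Q)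
      = (d (p + 3) Q * d (p + 5) Q * S) / (d (p + 4) Q * d (p + 4) Q * S)"
    using S by simp
  also have "\<dots> = d (p + 3) P * d (p + 5) P / (d (p + 4) P * d (p + 4) P)"
    unfolding 4 5 using nz by simp
  finally show ?thesis by (simp add: alpha_def d_def)
qed

end

section \<open>Invariance of \<open>\<alpha>\<close> and homogeneity\<close>

context generalized_plane_wave
begin

lemma alpha_eq_of_connection_preserving:
  assumes pos: "\<And>t. (deriv ^^ (p + 3)) f t > 0" "\<And>t. (deriv ^^ (p + 4)) f t > 0"
    and \<phi>: "diffeomorphism_between U V \<phi>" "preserves_connection U \<phi> nabla" and q: "q \<in> U"
  shows "alpha p f (\<phi> q) = alpha p f q"
proof -
  interpret connection_preserving_map nabla unbarred_part U V \<phi>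
    by (intro connection_preserving_map.intro degenerate_connection_axioms torsion_free_connection_axioms
        connection_preserving_map_axioms.intro \<phi>)
  show ?thesis
  proof (rule alpha_eq_of_intertwining[OF pos linear_derivative_phi[OF q]])
    show "inj (frechet_derivative \<phi> (at q))"
      using derivative_psi_phi[OF q] by (metis injI)
  qed (rule curvature_tensor_intertwines[OF q])
qed

lemma alpha_eq_of_affine_curvature_homogeneous:
  fixes P Q :: "real ^ 'n coord"
  assumes pos: "\<And>t. (deriv ^^ (p + 3)) f t > 0" "\<And>t. (deriv ^^ (p + 4)) f t > 0"
    and hom: "affine_curvature_homogeneous (p + 3) nabla"
  shows "alpha p f Q = alpha p f P"
proof -
  obtain \<phi> where \<phi>: "linear \<phi>" "bij \<phi>"
    and eq: "\<And>i vs. i \<le> p + 3 \<Longrightarrow> length vs = i + 3 \<Longrightarrow>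
      nabla_curvature_at nabla i Q (map \<phi> vs) = \<phi> (nabla_curvature_at nabla i P vs)"
    using hom unfolding affine_curvature_homogeneous_def by metis
  show ?thesis
  proof (rule alpha_eq_of_intertwining[OF pos \<phi>(1) bij_is_inj[OF \<phi>(2)]])
    show "curvature_tensor k Q (map \<phi> vs) = \<phi> (curvature_tensor k P vs)"
      if "k \<le> p + 3" "length vs = k + 3" for k vs
      using eq[OF that] that by (simp add: nabla_curvature_at_eq)
  qed
qed

end

theorem theorem1p3:
  fixes p :: nat
    and e :: "nat \<Rightarrow> 'n::finite"
    and f :: "real \<Rightarrow> real"
    and nabla :: "'n coord vfield \<Rightarrow> 'n coord vfield \<Rightarrow> 'n coord vfield"
  assumes "bij_betw e {0..p} (UNIV :: 'n set)"
    and "smooth_on UNIV f"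
    and "\<And>t. (deriv ^^ (p + 3)) f t > 0"
    and "\<And>t. (deriv ^^ (p + 4)) f t > 0"
    and "levi_civita_connection nabla (g_metric p e f)"
  shows "(\<forall>I \<in> scalar_weyl_invariants (g_metric p e f) nabla. \<forall>q. I q = 0) \<and>
    (affine_curvature_homogeneous (p + 3) nabla \<longrightarrow>
       (alpha p f :: real ^ 'n coord \<Rightarrow> real) constant_on UNIV) \<and>
    (\<forall>U V \<phi>. diffeomorphism_between U V \<phi> \<longrightarrow> preserves_connection U \<phi> nabla \<longrightarrow>
       (\<forall>q\<in>U. alpha p f (\<phi> q) = alpha p f q)) \<and>
    (\<not> (alpha p f :: real ^ 'n coord \<Rightarrow> real) constant_on UNIV \<longrightarrow>
       \<not> locally_affine_homogeneous nabla)"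
proof -
  interpret generalized_plane_wave nabla p e f
    by (intro generalized_plane_wave.intro generalized_plane_wave_axioms.intro assms)
  note preserved = alpha_eq_of_connection_preserving[OF assms(3,4)]
  have "(alpha p f :: real ^ 'n coord \<Rightarrow> real) constant_on UNIV"
    if "affine_curvature_homogeneous (p + 3) nabla"
    using alpha_eq_of_affine_curvature_homogeneous[OF assms(3,4) that] unfolding constant_on_def by blast
  moreover have "(alpha p f :: real ^ 'n coord \<Rightarrow> real) constant_on UNIV"
    if "locally_affine_homogeneous nabla"
  proof -
    have "alpha p f Q = alpha p f P" for P Q :: "real ^ 'n coord"
    proof -
      obtain U V \<Phi> where "P \<in> U" "diffeomorphism_between U V \<Phi>" "\<Phi> P = Q" "preserves_connection U \<Phi> nabla"
        using \<open>locally_affine_homogeneous nabla\<close> unfolding locally_affine_homogeneous_def by metis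
      then show ?thesis using preserved by metis
    qed
    then show ?thesis unfolding constant_on_def by blast
  qed
  ultimately show ?thesis
    using scalar_weyl_invariant_eq_0 preserved by blast
qed

end
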